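(* Let $N\ge1$, $c_N\ge1$, $\alpha>0$, and let $\mathbf{X}=(X_1,\dots,X_N)\sim\mathcal{N}_{\mathbb{C}^N}(0,B)$ and $\mathbf{Y}=(Y_1,\dots,Y_N)\in\mathbb{R}^N$ be two independent random vectors such that for every event $A\in\mathbf{Y}^{-1}(\mathcal{B}(\mathbb{R}^N))$ (of positive probability) there exists a random vector $\mathbf{Z}=(Z_1,\dots,Z_N)\sim\mathcal{N}_{\mathbb{C}^N}(0,B_A)$ on the same probability space satisfying: - for all $i\in\{1,\dots,N\}$, $\mathbb{E}(|Y_i|^2)\ge\alpha^2\,\mathbb{E}(|Z_i|^2)$ and $\mathbb{E}_A(|Y_i|^2)\le\mathbb{E}_A(|Z_i|^2)$; - for all $I\subsetneq\{1,\dots,N\}$, $\|C_I\|\,\|C_I^{-1}\|\le c_N$, where $C_I=\left(\frac{\mathrm{Cov}(Z_i,Z_j)}{\sqrt{V(Z_i)V(Z_j)}}\right)_{i,j\in I^c}$. Then, for all $x\in[0,+\infty)$ and all $y>\sqrt{2c_N}/\alpha$, $$1-\mathbb{P}\left(\exists i\in\{1,\dots,N\}:\ |X_i|^2\ge x^2V(X_i)\ \text{and}\ |Y_i|^2\le y^2\,\mathbb{E}(|Y_i|^2)\right)$$ $$\le\left(\frac{e\alpha^2y^2}{\alpha^2y^2-2c_N}\right)\left(b\left(\mu(x)+(1-\mu(x))\exp\left(1-\frac{\alpha^2y^2}{c_N}+2\ln(\alpha y)\right)\right)\right)^N,$$ where $b=\|C\|\,\|C^{-1}\|$ with $C=\left(\frac{\mathrm{Cov}(X_i,X_j)}{\sqrt{V(X_i)V(X_j)}}\right)_{1\le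 i,j\le N}$ and $\mu(x)=1-e^{-x^2/\|C\|}$.
   Context: For a positive definite Hermitian matrix $B$ of size $N$, $\mathcal{N}_{\mathbb{C}^N}(0,B)$ is the law on $\mathbb{C}^N$ with density $\frac{e^{-\langle z,B^{-1}z\rangle}}{\pi^N\det B}$ with respect to Lebesgue measure, $\langle,\rangle$ being the standard Hermitian product; then $\mathrm{Cov}(X_i,X_j)=\mathbb{E}(X_i\overline{X_j})=B_{ij}$ and $V(X_i)=\mathbb{E}(|X_i|^2)$. The matrices $B,B_A$ are positive definite Hermitian. $\|\cdot\|$ is the operator norm on Hermitian matrices for the standard Hermitian norm. $\mathbf{Y}^{-1}(\mathcal{B}(\mathbb{R}^N))$ is the $\sigma$-algebra generated by $\mathbf{Y}$. $\mathbb{E}_A(W)=\frac{1}{\mathbb{P}(A)}\int_AW\,d\mathbb{P}$ is the conditional expectation over $A$. $I^c=\{1,\dots,N\}\setminus I$. *)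

theory Defs
  imports "HOL-Probability.Probability"
begin

definition cvec_inner :: "complex ^ 'n \<Rightarrow> complex ^ 'n \<Rightarrow> complex" where
  "cvec_inner z w = (\<Sum>i\<in>UNIV. z $ i * cnj (w $ i))"

definition hermitian_mat :: "complex ^ 'n ^ 'n \<Rightarrow> bool" where
  "hermitian_mat B \<longleftrightarrow> (\<forall>i j. B $ i $ j = cnj (B $ j $ i))"

definition pos_def_hermitian :: "complex ^ 'n ^ 'n \<Rightarrow> bool" where
  "pos_def_hermitian B \<longleftrightarrow> hermitian_mat B \<and> (\<forall>v. v \<noteq> 0 \<longrightarrow> 0 < Re (cvec_inner v (B *v v)))"

text \<open>For \<open>B\<close> positive definite Hermitian, both \<open>\<langle>z, B\<^sup>-\<^sup>1 z\<rangle>\<close> and \<open>det B\<close> are real,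
  so \<open>Re\<close> below only changes the type.\<close>

definition complex_gaussian_density :: "complex ^ 'n ^ 'n \<Rightarrow> complex ^ 'n \<Rightarrow> real" where
  "complex_gaussian_density B z =
     exp (- Re (cvec_inner z (matrix_inv B *v z))) / (pi ^ CARD('n) * Re (det B))"

definition complex_gaussian :: "'a measure \<Rightarrow> ('a \<Rightarrow> complex ^ 'n) \<Rightarrow> complex ^ 'n ^ 'n \<Rightarrow> bool" where
  "complex_gaussian M X B \<longleftrightarrow>
     pos_def_hermitian B \<and>
     distributed M lborel X (\<lambda>z. ennreal (complex_gaussian_density B z))"

text \<open>Covariance and variance of centred complex random variables.\<close>

definition ccov :: "'a measure \<Rightarrow> ('a \<Rightarrow> complex) \<Rightarrow> ('a \<Rightarrow> complex) \<Rightarrow> complex" where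
  "ccov M U W = (LINT \<omega>|M. U \<omega> * cnj (W \<omega>))"

definition cvar :: "'a measure \<Rightarrow> ('a \<Rightarrow> complex) \<Rightarrow> real" where
  "cvar M U = (LINT \<omega>|M. (cmod (U \<omega>))\<^sup>2)"

definition correlation_mat :: "'a measure \<Rightarrow> ('a \<Rightarrow> complex ^ 'n) \<Rightarrow> complex ^ 'n ^ 'n" where
  "correlation_mat M X = (\<chi> i j.
     ccov M (\<lambda>\<omega>. X \<omega> $ i) (\<lambda>\<omega>. X \<omega> $ j) /
       complex_of_real (sqrt (cvar M (\<lambda>\<omega>. X \<omega> $ i) * cvar M (\<lambda>\<omega>. X \<omega> $ j))))"

definition event_expectation :: "'a measure \<Rightarrow> 'a set \<Rightarrow> ('a \<Rightarrow> real) \<Rightarrow> real" where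
  "event_expectation M A W = (LINT \<omega>:A|M. W \<omega>) / measure M A"

text \<open>The submatrix \<open>(A\<^sub>i\<^sub>j)\<^sub>i\<^sub>,\<^sub>j\<^sub>\<in>\<^sub>J\<close> is encoded by the pair \<open>J\<close>, \<open>A\<close>; entries of vectors and
  matrices outside \<open>J\<close> are ignored, so \<open>submat_norm J A\<close> is its operator norm for the Hermitian
  norm on \<open>\<complex>\<^sup>J\<close>, where \<open>J\<close> is meant to be nonempty.\<close>

definition submat_norm :: "'n set \<Rightarrow> complex ^ 'n ^ 'n \<Rightarrow> real" where
  "submat_norm J A =
     (SUP v \<in> {v :: complex ^ 'n. L2_set (\<lambda>j. cmod (v $ j)) J = 1}.
        L2_set (\<lambda>i. cmod (\<Sum>j\<in>J. A $ i $ j * v $ j)) J)"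

definition submat_inv :: "'n set \<Rightarrow> complex ^ 'n ^ 'n \<Rightarrow> complex ^ 'n ^ 'n" where
  "submat_inv J A = (SOME A'. \<forall>i\<in>J. \<forall>k\<in>J.
     (\<Sum>j\<in>J. A $ i $ j * A' $ j $ k) = (if i = k then 1 else 0) \<and>
     (\<Sum>j\<in>J. A' $ i $ j * A $ j $ k) = (if i = k then 1 else 0))"

lemma submat_inv_UNIV: "submat_inv UNIV A = matrix_inv A"
  unfolding submat_inv_def matrix_inv_def
  by (rule arg_cong[where f = Eps], rule ext)
    (auto simp: matrix_matrix_mult_def mat_def vec_eq_iff)

lemma submat_norm_UNIV: "submat_norm UNIV A = onorm ((*v) A)"
proof -
  have nrm: "L2_set (\<lambda>i. cmod (v $ i)) UNIV = norm v" for v :: "complex ^ 'a"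
    by (simp add: norm_vec_def)
  have img: "L2_set (\<lambda>i. cmod (\<Sum>j\<in>UNIV. A $ i $ j * v $ j)) UNIV = norm (A *v v)" for v
    by (simp add: norm_vec_def matrix_vector_mult_def)
  have bl: "bounded_linear ((*v) A)"
    by (rule linear_conv_bounded_linear[THEN iffD1])
      (auto intro!: linearI simp: matrix_vector_right_distrib vec_eq_iff
        matrix_vector_mult_def scaleR_sum_right)
  define S where "S = {v :: complex ^ 'a. norm v = 1}"
  have ne: "S \<noteq> {}"
    unfolding S_def by (auto intro!: exI[of _ "axis undefined 1"] simp: norm_axis_1)
  have le: "norm (A *v v) \<le> onorm ((*v) A)" if "v \<in> S" for v
    using onorm[OF bl, of v] that by (simp add: S_def)
  have bdd: "bdd_above ((\<lambda>v. norm (A *v v)) ` S)"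
    using le by (rule bdd_aboveI2)
  have "onorm ((*v) A) \<le> (SUP v\<in>S. norm (A *v v))"
  proof (rule onorm_le)
    fix x :: "complex ^ 'a"
    show "norm (A *v x) \<le> (SUP v\<in>S. norm (A *v v)) * norm x"
    proof (cases "x = 0")
      case False
      let ?u = "(1 / norm x) *\<^sub>R x"
      have "?u \<in> S" using False by (simp add: S_def)
      then have "norm (A *v ?u) \<le> (SUP v\<in>S. norm (A *v v))"
        using bdd by (rule cSUP_upper)
      moreover have "norm (A *v ?u) = norm (A *v x) / norm x"
        using linear_scale[OF bounded_linear.linear[OF bl], of "1 / norm x" x] by simp
      ultimately show ?thesis using False by (simp add: divide_le_eq)
    qed (simp add: bl linear_simps)
  qed
  moreover have "(SUP v\<in>S. norm (A *v v)) \<le> onorm ((*v) A)"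
    using ne le by (rule cSUP_least)
  ultimately show ?thesis
    unfolding submat_norm_def nrm img S_def by linarith
qed

end

theory Submission
  imports Defs
begin

text \<open>
  If no index is good, then with \<open>K = {i. |X\<^sub>i|\<^sup>2 < x\<^sup>2 V(X\<^sub>i)}\<close> every \<open>|Y\<^sub>i|\<close> with \<open>i \<notin> K\<close> is large. By
  independence the probability of this is at most \<open>\<Sum>\<^sub>K P(K\<^sub>X = K) P(Y is large on the complement of K)\<close>.

  The first factor is at most \<open>b\<^sup>N \<mu>\<^bsup>|K|\<^esup> (1 - \<mu>)\<^bsup>N - |K|\<^esup>\<close>, because the density of the normalized \<open>X\<close> is
  dominated by that of independent Gaussians of variance \<open>\<parallel>C\<parallel>\<close>; comparing with variance
  \<open>1 / \<parallel>C\<^sup>-\<^sup>1\<parallel>\<close> bounds the normalizing constant, so \<open>det C\<close> is never computed.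

  For the second factor let \<open>A\<close> be the event that \<open>|Y\<^sub>i|\<^sup>2 > y\<^sup>2 E|Y\<^sub>i|\<^sup>2\<close> for all \<open>i \<in> L\<close>. The vector \<open>Z\<close>
  belonging to \<open>A\<close> satisfies \<open>E\<^sub>A(\<Sum>\<^sub>i\<^sub>\<in>\<^sub>L |Z\<^sub>i|\<^sup>2 / V(Z\<^sub>i)) \<ge> t |L|\<close> with \<open>t = \<alpha>\<^sup>2y\<^sup>2\<close>, and an exponential Chebyshev
  bound with parameter \<open>1 / c\<^sub>N - 1 / t\<close> gives \<open>P(A) \<le> q\<^bsup>|L|\<^esup>\<close> with \<open>q = exp (1 - t / c\<^sub>N + ln t)\<close>. The
  binomial theorem sums the products to \<open>b\<^sup>N (\<mu> + (1 - \<mu>) q)\<^sup>N\<close>.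
\<close>

section \<open>Gaussian integrals\<close>

lemma prod_Basis_vec:
  fixes f :: "'b::euclidean_space ^ 'n \<Rightarrow> 'c::comm_monoid_mult"
  shows "(\<Prod>b\<in>Basis. f b) = (\<Prod>i\<in>UNIV. \<Prod>u\<in>Basis. f (axis i u))"
proof -
  have "(\<Prod>i\<in>UNIV. \<Prod>u\<in>Basis. f (axis i u)) = (\<Prod>(i,u)\<in>UNIV \<times> Basis. f (axis i u))"
    by (rule prod.cartesian_product)
  also have "\<dots> = (\<Prod>b\<in>(\<lambda>(i,u). axis i u) ` (UNIV \<times> Basis). f b)"
    by (subst prod.reindex) (auto simp: inj_on_def axis_eq_axis nonzero_Basis split_def)
  also have "(\<lambda>(i,u). axis i u) ` (UNIV \<times> Basis) = (Basis :: ('b ^ 'n) set)"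
    by (auto simp: Basis_vec_def)
  finally show ?thesis ..
qed

lemma measurable_vec_lambda [measurable]:
  "(\<lambda>f. \<chi> i. f i) \<in> (\<Pi>\<^sub>M i\<in>(UNIV :: 'n::finite set). borel) \<rightarrow>\<^sub>M (borel :: ('b::euclidean_space ^ 'n) measure)"
proof (subst borel_measurable_euclidean_space, rule ballI)
  fix b :: "'b ^ 'n" assume "b \<in> Basis"
  then obtain i u where b: "b = axis i u" by (auto simp: Basis_vec_def)
  show "(\<lambda>f. (\<chi> i. f i) \<bullet> b) \<in> (\<Pi>\<^sub>M i\<in>(UNIV :: 'n::finite set). borel) \<rightarrow>\<^sub>M borel"
    unfolding b inner_axis by simp measurable
qed

lemma borel_measurable_vec_nth [measurable (raw)]:
  fixes f :: "'a \<Rightarrow> 'b::euclidean_space ^ 'n"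
  assumes "f \<in> borel_measurable M"
  shows "(\<lambda>x. f x $ i) \<in> borel_measurable M"
  using borel_measurable_continuous_on[OF _ assms, of "\<lambda>v. v $ i"] by (simp add: continuous_on_component)

text \<open>Lebesgue measure is determined by its values on boxes, and the coordinate tuples of the
  points of a box form a product of boxes.\<close>

lemma lborel_vec_eq:
  "lborel = distr (\<Pi>\<^sub>M i\<in>(UNIV :: 'n::finite set). lborel) borel (\<lambda>f. (\<chi> i. f i) :: 'b::euclidean_space ^ 'n)"
proof (rule lborel_eqI)
  interpret product_sigma_finite "\<lambda>_ :: 'n. lborel :: 'b measure" by standard
  fix l u :: "'b ^ 'n"
  assume le: "\<And>b. b \<in> Basis \<Longrightarrow> l \<bullet> b \<le> u \<bullet> b"
  have le': "l $ i \<bullet> b \<le> u $ i \<bullet> b" if "b \<in> Basis" for i b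
    using le[OF axis_in_Basis_iff[THEN iffD2, OF that], of i] by (simp add: inner_axis)
  have [simp]: "sets (\<Pi>\<^sub>M i\<in>(UNIV :: 'n::finite set). lborel :: 'b measure) = sets (\<Pi>\<^sub>M i\<in>UNIV. borel)"
    by (rule sets_PiM_cong) auto
  have m: "(\<lambda>f. \<chi> i. f i) \<in> (\<Pi>\<^sub>M i\<in>(UNIV :: 'n::finite set). lborel) \<rightarrow>\<^sub>M (borel :: ('b ^ 'n) measure)"
    using measurable_vec_lambda by (subst measurable_cong_sets) auto
  have "(\<lambda>f. (\<chi> i. f i) :: 'b ^ 'n) -` box l u \<inter> space (\<Pi>\<^sub>M i\<in>UNIV. lborel) = (\<Pi>\<^sub>E i\<in>UNIV. box (l $ i) (u $ i))"
    by (auto simp: mem_box Basis_vec_def inner_axis space_PiM PiE_def Pi_iff)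
  then have "emeasure (distr (\<Pi>\<^sub>M i\<in>(UNIV :: 'n::finite set). lborel) borel (\<lambda>f. (\<chi> i. f i) :: 'b ^ 'n)) (box l u)
     = (\<Prod>i\<in>UNIV. emeasure lborel (box (l $ i) (u $ i)))"
    by (simp add: emeasure_distr[OF m] emeasure_PiM)
  also have "\<dots> = ennreal (\<Prod>i\<in>UNIV. \<Prod>b\<in>Basis. (u $ i - l $ i) \<bullet> b)"
    using le' by (simp add: prod_ennreal prod_nonneg inner_diff_left)
  also have "(\<Prod>i\<in>UNIV. \<Prod>b\<in>Basis. (u $ i - l $ i) \<bullet> b) = (\<Prod>b\<in>Basis. (u - l) \<bullet> b)"
    by (simp add: prod_Basis_vec inner_axis)
  finally show "emeasure (distr (\<Pi>\<^sub>M i\<in>(UNIV :: 'n::finite set). lborel) borel (\<lambda>f. (\<chi> i. f i) :: 'b ^ 'n)) (box l u)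
     = (\<Prod>b\<in>Basis. (u - l) \<bullet> b)" .
qed simp

text \<open>Tonelli over the coordinates; it reduces the comparison integrals over
  \<open>complex ^ 'n\<close> to integrals over the plane.\<close>

lemma nn_integral_lborel_vec_prod:
  fixes f :: "'n::finite \<Rightarrow> 'b::euclidean_space \<Rightarrow> ennreal"
  assumes [measurable]: "\<And>i. f i \<in> borel_measurable borel"
  shows "(\<integral>\<^sup>+z. (\<Prod>i\<in>UNIV. f i (z $ i)) \<partial>lborel) = (\<Prod>i\<in>UNIV. \<integral>\<^sup>+w. f i w \<partial>lborel)"
proof -
  interpret product_sigma_finite "\<lambda>_ :: 'n. lborel :: 'b measure" by standard
  have [simp]: "sets (\<Pi>\<^sub>M i\<in>(UNIV :: 'n::finite set). lborel :: 'b measure) = sets (\<Pi>\<^sub>M i\<in>UNIV. borel)"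
    by (rule sets_PiM_cong) auto
  have m: "(\<lambda>f. \<chi> i. f i) \<in> (\<Pi>\<^sub>M i\<in>(UNIV :: 'n::finite set). lborel) \<rightarrow>\<^sub>M (borel :: ('b ^ 'n) measure)"
    using measurable_vec_lambda by (subst measurable_cong_sets) auto
  show ?thesis
    by (subst lborel_vec_eq, subst nn_integral_distr[OF m])
       (simp_all add: product_nn_integral_prod)
qed

section \<open>Gaussian integrals over the complex plane\<close>

lemma emeasure_lborel_complex_annulus:
  assumes "0 \<le> r" "r \<le> v"
  shows "emeasure lborel {z :: complex. r \<le> (cmod z)\<^sup>2 \<and> (cmod z)\<^sup>2 \<le> v} = ennreal (pi * (v - r))"
proof -
  have "r \<le> n\<^sup>2 \<longleftrightarrow> sqrt r \<le> n" "n\<^sup>2 \<le> v \<longleftrightarrow> n \<le> sqrt v" if "0 \<le> n" for n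
    using assms that real_sqrt_le_iff[of "n\<^sup>2" v] real_sqrt_le_iff[of r "n\<^sup>2"] by auto
  then have eq: "{z :: complex. r \<le> (cmod z)\<^sup>2 \<and> (cmod z)\<^sup>2 \<le> v} = cball 0 (sqrt v) - ball 0 (sqrt r)"
    by auto
  have b: "ball (0::complex) (sqrt r) \<subseteq> cball 0 (sqrt v)"
    using assms by (simp add: ball_subset_cball_iff)
  have "emeasure lborel (cball (0::complex) (sqrt v)) = ennreal (pi * v)"
    using assms by (simp add: emeasure_cball eval_unit_ball_vol)
  moreover have "emeasure lborel (ball (0::complex) (sqrt r)) = ennreal (pi * r)"
    using assms by (simp add: emeasure_ball eval_unit_ball_vol)
  ultimately show ?thesis
    unfolding eq using assms b
    by (subst emeasure_Diff) (auto simp: ennreal_minus right_diff_distrib)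
qed

text \<open>A layer-cake argument in place of polar coordinates:
  \<open>exp (- (cmod z)\<^sup>2 / s)\<close> is the integral of \<open>exp (- v / s) / s\<close>
  over \<open>v \<ge> (cmod z)\<^sup>2\<close>, and after the swap the inner integral is the area of
  an annulus.\<close>

lemma nn_integral_complex_gaussian_tail:
  assumes s: "0 < s" and r: "0 \<le> r"
  shows "(\<integral>\<^sup>+z. ennreal (exp (- (cmod z)\<^sup>2 / s)) * indicator {z. r \<le> (cmod z)\<^sup>2} z \<partial>lborel)
    = ennreal (pi * s * exp (- r / s))"
proof -
  have int: "(\<integral>\<^sup>+v. ennreal (exp (- v / s) / s) * indicator {a..} v \<partial>lborel) = ennreal (exp (- a / s))" for a
  proof -
    have "((\<lambda>v. - exp (- v / s)) \<longlongrightarrow> 0) at_top" using s by real_asymp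
    then show ?thesis
      using s by (subst nn_integral_FTC_atLeast[where F = "\<lambda>v. - exp (- v / s)" and T = 0])
        (auto intro!: derivative_eq_intros)
  qed
  have "(\<integral>\<^sup>+z. ennreal (exp (- (cmod z)\<^sup>2 / s)) * indicator {z. r \<le> (cmod z)\<^sup>2} z \<partial>lborel)
    = (\<integral>\<^sup>+z. (\<integral>\<^sup>+v. ennreal (exp (- v / s) / s) * indicator {(cmod z)\<^sup>2..} v * indicator {z. r \<le> (cmod z)\<^sup>2} z \<partial>lborel) \<partial>lborel)"
    by (subst nn_integral_multc) (simp_all add: int[simplified])
  also have "\<dots> = (\<integral>\<^sup>+v. (\<integral>\<^sup>+z. ennreal (exp (- v / s) / s) * indicator {(cmod z)\<^sup>2..} v * indicator {z. r \<le> (cmod z)\<^sup>2} z \<partial>lborel) \<partial>lborel)"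
    by (rule lborel_pair.Fubini') (simp add: indicator_def)
  also have "\<dots> = (\<integral>\<^sup>+v. ennreal (pi * (v - r) * (exp (- v / s) / s)) * indicator {r..} v \<partial>lborel)"
  proof (rule nn_integral_cong)
    fix v :: real
    have "(\<integral>\<^sup>+(z::complex). ennreal (exp (- v / s) / s) * indicator {(cmod z)\<^sup>2..} v * indicator {z. r \<le> (cmod z)\<^sup>2} z \<partial>lborel)
      = (\<integral>\<^sup>+(z::complex). ennreal (exp (- v / s) / s) * indicator {z. r \<le> (cmod z)\<^sup>2 \<and> (cmod z)\<^sup>2 \<le> v} z \<partial>lborel)"
      by (rule nn_integral_cong) (auto split: split_indicator)
    also have "\<dots> = ennreal (exp (- v / s) / s) * emeasure lborel {z :: complex. r \<le> (cmod z)\<^sup>2 \<and> (cmod z)\<^sup>2 \<le> v}"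
      by (rule nn_integral_cmult_indicator) simp
    also have "\<dots> = ennreal (pi * (v - r) * (exp (- v / s) / s)) * indicator {r..} v"
    proof (cases "r \<le> v")
      case True
      then show ?thesis using s r
        by (subst emeasure_lborel_complex_annulus) (auto simp: ennreal_mult'[symmetric] mult_ac)
    next
      case False
      then have "{z :: complex. r \<le> (cmod z)\<^sup>2 \<and> (cmod z)\<^sup>2 \<le> v} = {}" by auto
      then show ?thesis using False by (simp only: emeasure_empty) simp
    qed
    finally show "(\<integral>\<^sup>+(z::complex). ennreal (exp (- v / s) / s) * indicator {(cmod z)\<^sup>2..} v * indicator {z. r \<le> (cmod z)\<^sup>2} z \<partial>lborel)
      = ennreal (pi * (v - r) * (exp (- v / s) / s)) * indicator {r..} v" .
  qed
  \<comment> \<open>The antiderivative comes from integration by parts; the right-hand side is its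
    limit \<open>0\<close> at infinity minus its value at \<open>r\<close>.\<close>
  also have "\<dots> = ennreal (0 - - (pi * (r - r + s) * exp (- r / s)))"
  proof (rule nn_integral_FTC_atLeast[where F = "\<lambda>v. - (pi * (v - r + s) * exp (- v / s))"])
    show "((\<lambda>v. - (pi * (v - r + s) * exp (- v / s))) \<longlongrightarrow> 0) at_top" using s by real_asymp
    show "((\<lambda>v. - (pi * (v - r + s) * exp (- v / s))) has_real_derivative pi * (v - r) * (exp (- v / s) / s)) (at v)" for v
      using s by (auto intro!: derivative_eq_intros simp: field_simps)
  qed (use s in auto)
  finally show ?thesis by (simp add: mult_ac)
qed

lemma nn_integral_complex_gaussian:
  assumes "0 < s"
  shows "(\<integral>\<^sup>+z. ennreal (exp (- (cmod z)\<^sup>2 / s)) \<partial>lborel) = ennreal (pi * s)"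
  using nn_integral_complex_gaussian_tail[OF assms, of 0] by simp

lemma nn_integral_complex_gaussian_disc:
  assumes s: "0 < s" and r: "0 \<le> r"
  shows "(\<integral>\<^sup>+z. ennreal (exp (- (cmod z)\<^sup>2 / s)) * indicator {z. (cmod z)\<^sup>2 < r} z \<partial>lborel)
    = ennreal (pi * s * (1 - exp (- r / s)))"
proof -
  let ?I = "\<lambda>S. \<integral>\<^sup>+z. ennreal (exp (- (cmod z)\<^sup>2 / s)) * indicator S z \<partial>lborel"
  have "?I {z. (cmod z)\<^sup>2 < r} + ?I {z. r \<le> (cmod z)\<^sup>2} = (\<integral>\<^sup>+z. ennreal (exp (- (cmod z)\<^sup>2 / s)) \<partial>lborel)"
    by (subst nn_integral_add[symmetric]) (auto intro!: nn_integral_cong split: split_indicator)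
  \<comment> \<open>The total mass is split so that the tail, which is finite, can be cancelled in
    \<open>ennreal\<close>.\<close>
  also have "\<dots> = ennreal (pi * s * (1 - exp (- r / s))) + ?I {z. r \<le> (cmod z)\<^sup>2}"
    using assms unfolding nn_integral_complex_gaussian_tail[OF s r] nn_integral_complex_gaussian[OF s]
    by (subst ennreal_plus[symmetric]) (auto simp: algebra_simps mult_left_le)
  finally show ?thesis
    unfolding nn_integral_complex_gaussian_tail[OF s r] by (simp add: add.commute[of _ "ennreal (pi * s * exp (- r / s))"] )
qed

text \<open>Completing the square and translation invariance. This is the planar identity behind the
  linearization in \<open>exponential_moment\<close>.\<close>

lemma nn_integral_complex_gaussian_shift:
  "(\<integral>\<^sup>+g. ennreal (exp (2 * Re (w * cnj g) - (cmod g)\<^sup>2)) \<partial>lborel) = ennreal (pi * exp ((cmod w)\<^sup>2))"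
proof -
  \<comment> \<open>The division by 1 matches the integrand of
    \<open>nn_integral_complex_gaussian\<close> at \<open>s = 1\<close>.\<close>
  have eq: "2 * Re (w * cnj g) - (cmod g)\<^sup>2 = (cmod w)\<^sup>2 - (cmod (- w + g))\<^sup>2 / 1" for g
    unfolding cmod_power2 by (simp add: power2_eq_square algebra_simps)
  have "(\<integral>\<^sup>+g. ennreal (exp (2 * Re (w * cnj g) - (cmod g)\<^sup>2)) \<partial>lborel)
    = ennreal (exp ((cmod w)\<^sup>2)) * (\<integral>\<^sup>+g. ennreal (exp (- (cmod (- w + g))\<^sup>2 / 1)) \<partial>lborel)"
    unfolding eq exp_diff by (subst nn_integral_cmult[symmetric]) (auto simp: ennreal_mult'[symmetric] exp_minus divide_inverse)
  also have "(\<integral>\<^sup>+g. ennreal (exp (- (cmod (- w + g))\<^sup>2 / 1)) \<partial>lborel)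
    = (\<integral>\<^sup>+g. ennreal (exp (- (cmod g)\<^sup>2 / 1)) \<partial>distr lborel borel ((+) (- w)))"
    by (subst nn_integral_distr) auto
  finally show ?thesis
    unfolding lborel_distr_plus by (subst (asm) nn_integral_complex_gaussian) (auto simp: ennreal_mult'[symmetric] mult.commute)
qed

section \<open>Quadratic forms and condition numbers\<close>

lemma cvec_inner_add_left: "cvec_inner (u + v) w = cvec_inner u w + cvec_inner v w"
  by (simp add: cvec_inner_def sum.distrib distrib_right)

lemma cvec_inner_add_right: "cvec_inner u (v + w) = cvec_inner u v + cvec_inner u w"
  by (simp add: cvec_inner_def sum.distrib distrib_left)

lemma cvec_inner_diff_left: "cvec_inner (u - v) w = cvec_inner u w - cvec_inner v w"
  by (simp add: cvec_inner_def sum_subtractf left_diff_distrib)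

lemma cvec_inner_minus_left: "cvec_inner (- u) w = - cvec_inner u w"
  by (simp add: cvec_inner_def sum_negf)

lemma cvec_inner_minus_right: "cvec_inner u (- w) = - cvec_inner u w"
  by (simp add: cvec_inner_def sum_negf)

lemma cnj_cvec_inner: "cnj (cvec_inner u w) = cvec_inner w u"
  by (simp add: cvec_inner_def cnj_sum mult.commute)

lemma Re_cvec_inner_commute: "Re (cvec_inner u w) = Re (cvec_inner w u)"
  using arg_cong[OF cnj_cvec_inner[of u w], of Re] by simp

lemma Re_cvec_inner_self: "Re (cvec_inner u u) = (\<Sum>i\<in>UNIV. (cmod (u $ i))\<^sup>2)"
  unfolding cvec_inner_def Re_sum
  by (rule sum.cong) (simp_all add: complex_norm_square[symmetric] del: of_real_power)

lemma hermitian_mat_cnj: "hermitian_mat B \<Longrightarrow> cnj (B $ i $ j) = B $ j $ i"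
  unfolding hermitian_mat_def by metis

lemma cvec_inner_hermitian:
  assumes "hermitian_mat B"
  shows "cvec_inner (B *v u) w = cvec_inner u (B *v w)"
proof -
  have "cvec_inner (B *v u) w = (\<Sum>i\<in>UNIV. \<Sum>j\<in>UNIV. B $ i $ j * u $ j * cnj (w $ i))"
    by (simp add: cvec_inner_def matrix_vector_mult_def sum_distrib_right)
  also have "\<dots> = (\<Sum>j\<in>UNIV. \<Sum>i\<in>UNIV. B $ i $ j * u $ j * cnj (w $ i))"
    by (rule sum.swap)
  also have "\<dots> = (\<Sum>j\<in>UNIV. \<Sum>i\<in>UNIV. u $ j * cnj (B $ j $ i * w $ i))"
    by (simp add: hermitian_mat_cnj[OF assms] mult_ac)
  also have "\<dots> = cvec_inner u (B *v w)"
    by (simp add: cvec_inner_def matrix_vector_mult_def sum_distrib_left cnj_sum)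
  finally show ?thesis .
qed

lemma pos_def_hermitianD:
  assumes "pos_def_hermitian B"
  shows "hermitian_mat B" "v \<noteq> 0 \<Longrightarrow> 0 < Re (cvec_inner v (B *v v))"
    "0 \<le> Re (cvec_inner v (B *v v))"
proof -
  show "hermitian_mat B" "v \<noteq> 0 \<Longrightarrow> 0 < Re (cvec_inner v (B *v v))"
    using assms by (auto simp: pos_def_hermitian_def)
  then show "0 \<le> Re (cvec_inner v (B *v v))"
    by (cases "v = 0") (auto simp: cvec_inner_def less_imp_le)
qed

lemma cvec_inner_axis: "cvec_inner (axis i 1) v = cnj (v $ i)"
proof -
  have "cvec_inner (axis i 1) v = (\<Sum>k\<in>UNIV. if k = i then cnj (v $ i) else 0)"
    unfolding cvec_inner_def by (rule sum.cong) (auto simp: axis_def)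
  then show ?thesis by simp
qed

lemma pos_def_hermitian_diag:
  assumes "pos_def_hermitian B"
  shows "0 < Re (B $ i $ i)" "B $ i $ i = of_real (Re (B $ i $ i))"
proof -
  have "(B *v axis i 1) $ i = B $ i $ i"
    by (simp add: matrix_vector_mult_def axis_def if_distrib cong: if_cong)
  then show "0 < Re (B $ i $ i)"
    using pos_def_hermitianD(2)[OF assms, of "axis i 1"] by (simp add: cvec_inner_axis axis_eq_0_iff)
  have "B $ i $ i = cnj (B $ i $ i)"
    using pos_def_hermitianD(1)[OF assms] unfolding hermitian_mat_def by blast
  then show "B $ i $ i = of_real (Re (B $ i $ i))"
    by (metis Reals_cnj_iff of_real_Re)
qed

text \<open>A definite form has trivial kernel, so \<open>B\<close> is invertible and the choice
  behind \<open>matrix_inv\<close> yields a genuine inverse.\<close>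

lemma pos_def_hermitian_inv:
  assumes "pos_def_hermitian B"
  shows "B ** matrix_inv B = mat 1" "matrix_inv B ** B = mat 1"
proof -
  have "x = 0" if "B *v x = 0" for x
    using pos_def_hermitianD(2)[OF assms, of x] that by (auto simp: cvec_inner_def)
  then have "invertible B"
    using matrix_left_invertible_ker[of B] by (auto simp: invertible_left_inverse)
  then have "\<exists>A'. B ** A' = mat 1 \<and> A' ** B = mat 1"
    by (simp add: invertible_def)
  from someI_ex[OF this] show "B ** matrix_inv B = mat 1" "matrix_inv B ** B = mat 1"
    by (simp_all add: matrix_inv_def)
qed

lemma pos_def_hermitian_inv_mult:
  assumes "pos_def_hermitian B"
  shows "B *v (matrix_inv B *v z) = z" "matrix_inv B *v (B *v z) = z"
  by (simp_all add: matrix_vector_mul_assoc pos_def_hermitian_inv[OF assms])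

text \<open>A displacement by \<open>B *v u\<close> cancels the inverse in the mixed and the last
  terms. It serves both the moment generating function and the lower bound for the inverse
  form.\<close>

lemma inv_complete_square:
  assumes "pos_def_hermitian B"
  shows "Re (cvec_inner (z + B *v u) (matrix_inv B *v (z + B *v u)))
    = Re (cvec_inner z (matrix_inv B *v z)) + 2 * Re (cvec_inner z u) + Re (cvec_inner u (B *v u))"
proof -
  have "cvec_inner (B *v u) (matrix_inv B *v z) = cvec_inner u z"
    by (metis assms cvec_inner_hermitian pos_def_hermitianD(1) pos_def_hermitian_inv_mult(1))
  then show ?thesis
    using Re_cvec_inner_commute[of z u] Re_cvec_inner_commute[of "B *v u" u]
    by (simp add: matrix_vector_right_distrib cvec_inner_add_left cvec_inner_add_right
        pos_def_hermitian_inv_mult[OF assms])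
qed

lemma matrix_vector_mult_minus_right: "(A :: complex ^ 'n ^ 'm) *v (- u) = - (A *v u)"
  by (simp add: vec_eq_iff matrix_vector_mult_def sum_negf)

text \<open>Nonnegativity of the inverse form at \<open>z - B *v u\<close>. By this half of Legendre
  duality an upper bound on the form of \<open>B\<close> gives a lower bound on that of its inverse,
  without eigenvalues.\<close>

lemma inv_quadratic_lower:
  assumes "pos_def_hermitian B"
  shows "2 * Re (cvec_inner z u) - Re (cvec_inner u (B *v u)) \<le> Re (cvec_inner z (matrix_inv B *v z))"
proof -
  have "0 \<le> Re (cvec_inner (z + B *v (- u)) (matrix_inv B *v (z + B *v (- u))))"
    by (metis assms Re_cvec_inner_commute pos_def_hermitianD(3) pos_def_hermitian_inv_mult(1))
  then show ?thesis
    unfolding inv_complete_square[OF assms]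
    by (simp add: matrix_vector_mult_minus_right cvec_inner_minus_left cvec_inner_minus_right)
qed

section \<open>Operator norms and inverses of submatrices\<close>

lemma L2_set_submat_le:
  assumes "L2_set (\<lambda>j. cmod (v $ j)) J = 1"
  shows "L2_set (\<lambda>i. cmod (\<Sum>j\<in>J. A $ i $ j * v $ j)) J \<le> submat_norm J A"
proof -
  \<comment> \<open>The supremum in \<open>submat_norm\<close> is usable only for a set bounded
    above: unit vectors have entries of modulus at most 1 on \<open>J\<close>, so the sum of all
    moduli in the block is a bound.\<close>
  have "L2_set (\<lambda>i. cmod (\<Sum>j\<in>J. A $ i $ j * v $ j)) J \<le> (\<Sum>i\<in>J. \<Sum>j\<in>J. cmod (A $ i $ j))"
    if v: "L2_set (\<lambda>j. cmod (v $ j)) J = 1" for v :: "complex ^ 'a"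
  proof -
    have "cmod (v $ j) \<le> 1" if "j \<in> J" for j
      using member_le_L2_set[of J j "\<lambda>j. cmod (v $ j)"] that v by simp
    then have "cmod (\<Sum>j\<in>J. A $ i $ j * v $ j) \<le> (\<Sum>j\<in>J. cmod (A $ i $ j))" for i
      by (intro sum_norm_le) (simp add: norm_mult mult_left_le)
    then show ?thesis
      by (intro order.trans[OF L2_set_le_sum] sum_mono) auto
  qed
  then show ?thesis
    unfolding submat_norm_def using assms
    by (intro cSUP_upper) (auto intro!: bdd_aboveI2)
qed

lemma submat_norm_bound:
  "L2_set (\<lambda>i. cmod (\<Sum>j\<in>J. A $ i $ j * v $ j)) J \<le> submat_norm J A * L2_set (\<lambda>j. cmod (v $ j)) J"
proof (cases "L2_set (\<lambda>j. cmod (v $ j)) J = 0")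
  case True
  \<comment> \<open>A vector of length zero on \<open>J\<close> may be nonzero elsewhere, but only
    its entries in \<open>J\<close> enter.\<close>
  then have "v $ j = 0" if "j \<in> J" for j
    using that by (simp add: L2_set_eq_0_iff)
  then have "L2_set (\<lambda>i. cmod (\<Sum>j\<in>J. A $ i $ j * v $ j)) J = 0"
    by (simp add: L2_set_eq_0_iff)
  with True show ?thesis by simp
next
  case False
  define n where "n = L2_set (\<lambda>j. cmod (v $ j)) J"
  have n: "n > 0" using False by (simp add: n_def order.strict_iff_order)
  define w where "w = (\<chi> i. of_real (1 / n) * v $ i)"
  have scale: "L2_set (\<lambda>i. cmod (of_real (1 / n) * f i)) J = L2_set (\<lambda>i. cmod (f i)) J / n" for f
    using n by (simp add: norm_mult norm_divide L2_set_right_distrib[of "1/n", simplified] L2_set_def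
         power_divide sum_divide_distrib[symmetric] real_sqrt_divide)
  have "L2_set (\<lambda>j. cmod (w $ j)) J = 1"
    using n unfolding w_def vec_lambda_beta scale by (simp add: n_def)
  from L2_set_submat_le[OF this, of A]
  have "L2_set (\<lambda>i. cmod (of_real (1 / n) * (\<Sum>j\<in>J. A $ i $ j * v $ j))) J \<le> submat_norm J A"
    by (simp add: w_def sum_distrib_left mult_ac)
  then show ?thesis
    unfolding scale n_def[symmetric] using n by (simp add: divide_le_eq)
qed

lemma submat_quadratic_le:
  "Re (\<Sum>i\<in>J. v $ i * cnj (\<Sum>j\<in>J. A $ i $ j * v $ j)) \<le> submat_norm J A * (\<Sum>i\<in>J. (cmod (v $ i))\<^sup>2)"
proof -
  have "Re (\<Sum>i\<in>J. v $ i * cnj (\<Sum>j\<in>J. A $ i $ j * v $ j))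
    \<le> cmod (\<Sum>i\<in>J. v $ i * cnj (\<Sum>j\<in>J. A $ i $ j * v $ j))"
    by (rule complex_Re_le_cmod)
  also have "\<dots> \<le> (\<Sum>i\<in>J. \<bar>cmod (v $ i)\<bar> * \<bar>cmod (\<Sum>j\<in>J. A $ i $ j * v $ j)\<bar>)"
    by (rule sum_norm_le) (simp add: norm_mult del: cnj_sum)
  also have "\<dots> \<le> L2_set (\<lambda>i. cmod (v $ i)) J * L2_set (\<lambda>i. cmod (\<Sum>j\<in>J. A $ i $ j * v $ j)) J"
    by (rule L2_set_mult_ineq)
  also have "\<dots> \<le> L2_set (\<lambda>i. cmod (v $ i)) J * (submat_norm J A * L2_set (\<lambda>j. cmod (v $ j)) J)"
    by (intro mult_left_mono submat_norm_bound) simp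
  also have "\<dots> = submat_norm J A * (L2_set (\<lambda>i. cmod (v $ i)) J)\<^sup>2"
    by (simp add: power2_eq_square mult_ac)
  finally show ?thesis by (simp add: L2_set_def sum_nonneg)
qed

lemma quadratic_le_onorm:
  "Re (cvec_inner v (A *v v)) \<le> onorm ((*v) A) * (\<Sum>i\<in>UNIV. (cmod (v $ i))\<^sup>2)"
  using submat_quadratic_le[where J = UNIV and v = v and A = A]
  by (simp add: submat_norm_UNIV cvec_inner_def matrix_vector_mult_def)

text \<open>Testing the norm on a basis vector bounds a whole column. Applied to diagonal entries,
  this yields the lower bounds 1 for norms.\<close>

lemma cmod_entry_le_submat_norm:
  assumes "i \<in> J" "j \<in> J"
  shows "cmod (A $ i $ j) \<le> submat_norm J A"
proof -
  let ?e = "axis j 1 :: complex ^ 'a"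
  have "(cmod (?e $ k))\<^sup>2 = (if k = j then 1 else 0)" for k by (simp add: axis_def)
  then have one: "L2_set (\<lambda>k. cmod (?e $ k)) J = 1" using assms by (simp add: L2_set_def)
  have "A $ l $ k * ?e $ k = (if k = j then A $ l $ k else 0)" for l k by (simp add: axis_def)
  then have "(\<Sum>k\<in>J. A $ l $ k * ?e $ k) = A $ l $ j" for l using assms by simp
  then have "L2_set (\<lambda>l. cmod (A $ l $ j)) J \<le> submat_norm J A"
    using L2_set_submat_le[OF one, of A] by simp
  then show ?thesis
    using member_le_L2_set[of J i "\<lambda>l. cmod (A $ l $ j)"] assms by simp
qed

text \<open>The choice in \<open>submat_inv\<close> needs a witness. Extending the block of
  \<open>C\<close> by the identity outside \<open>J\<close> gives a positive definite
  \<open>G\<close> without entries linking \<open>J\<close> to its complement, so the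
  \<open>J\<close> block of its inverse inverts the block of \<open>C\<close>.\<close>

lemma submat_inv_works:
  assumes C: "pos_def_hermitian C"
  shows "\<forall>i\<in>J. \<forall>k\<in>J.
     (\<Sum>j\<in>J. C $ i $ j * submat_inv J C $ j $ k) = (if i = k then 1 else 0) \<and>
     (\<Sum>j\<in>J. submat_inv J C $ i $ j * C $ j $ k) = (if i = k then 1 else 0)"
proof -
  define G :: "complex ^ 'a ^ 'a" where
    "G = (\<chi> i j. if i \<in> J \<and> j \<in> J then C $ i $ j else if i = j then 1 else 0)"
  have sum_J: "(\<Sum>j\<in>UNIV. g j) = (\<Sum>j\<in>J. g j) + (\<Sum>j\<in>-J. g j)" for g :: "'a \<Rightarrow> complex"
    by (metis Compl_eq_Diff_UNIV add.commute finite subset_UNIV sum.subset_diff)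
  have Gv: "(G *v v) $ i = (if i \<in> J then \<Sum>j\<in>J. C $ i $ j * v $ j else v $ i)" for v i
    by (auto simp: G_def matrix_vector_mult_def sum_J if_distrib[of "\<lambda>a. a * _"] sum.delta'
        cong: if_cong intro!: sum.neutral)
  have "0 < Re (cvec_inner v (G *v v))" if "v \<noteq> 0" for v
  proof -
    \<comment> \<open>The form of \<open>G\<close> at \<open>v\<close> is the form of
      \<open>C\<close> at \<open>w\<close> plus the squared length of \<open>v\<close> outside
      \<open>J\<close>. The first summand is positive if \<open>w \<noteq> 0\<close>, the second if
      \<open>w = 0\<close>.\<close>
    define w where "w = (\<chi> i. if i \<in> J then v $ i else 0)"
    have "(C *v w) $ i = (\<Sum>j\<in>J. C $ i $ j * v $ j)" for i
      by (simp add: matrix_vector_mult_def sum_J w_def)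
    then have "cvec_inner v (G *v v) = cvec_inner w (C *v w) + (\<Sum>j\<in>-J. v $ j * cnj (v $ j))"
      by (simp add: cvec_inner_def sum_J Gv) (simp add: w_def)
    then have eq: "Re (cvec_inner v (G *v v)) = Re (cvec_inner w (C *v w)) + (\<Sum>j\<in>-J. (cmod (v $ j))\<^sup>2)"
      by (simp add: complex_norm_square[symmetric] del: of_real_power)
    show ?thesis
    proof (cases "w = 0")
      case False
      then show ?thesis
        unfolding eq using pos_def_hermitianD(2)[OF C] by (simp add: add_pos_nonneg sum_nonneg)
    next
      case True
      from that obtain k where k: "v $ k \<noteq> 0" by (auto simp: vec_eq_iff)
      moreover have "k \<in> -J"
        using True k by (auto simp: w_def vec_eq_iff split: if_splits)
      ultimately have "0 < (\<Sum>j\<in>-J. (cmod (v $ j))\<^sup>2)" by (intro sum_pos2[where i = k]) auto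
      then show ?thesis
        unfolding eq using pos_def_hermitianD(3)[OF C, of w] by simp
    qed
  qed
  moreover have "hermitian_mat G"
    by (simp add: hermitian_mat_def G_def hermitian_mat_cnj[OF pos_def_hermitianD(1)[OF C]])
  ultimately have G: "pos_def_hermitian G" by (simp add: pos_def_hermitian_def)
  have "\<forall>i\<in>J. \<forall>k\<in>J.
     (\<Sum>j\<in>J. C $ i $ j * matrix_inv G $ j $ k) = (if i = k then 1 else 0) \<and>
     (\<Sum>j\<in>J. matrix_inv G $ i $ j * C $ j $ k) = (if i = k then 1 else 0)"
  proof (intro ballI conjI)
    fix i k assume ik: "i \<in> J" "k \<in> J"
    have "(G ** matrix_inv G) $ i $ k = (\<Sum>j\<in>J. C $ i $ j * matrix_inv G $ j $ k)"
      using ik by (auto simp: matrix_matrix_mult_def sum_J G_def intro!: sum.neutral)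
    then show "(\<Sum>j\<in>J. C $ i $ j * matrix_inv G $ j $ k) = (if i = k then 1 else 0)"
      by (simp add: pos_def_hermitian_inv[OF G] mat_def)
    have "(matrix_inv G ** G) $ i $ k = (\<Sum>j\<in>J. matrix_inv G $ i $ j * C $ j $ k)"
      using ik by (auto simp: matrix_matrix_mult_def sum_J G_def intro!: sum.neutral)
    then show "(\<Sum>j\<in>J. matrix_inv G $ i $ j * C $ j $ k) = (if i = k then 1 else 0)"
      by (simp add: pos_def_hermitian_inv[OF G] mat_def)
  qed
  then show ?thesis
    unfolding submat_inv_def by (rule someI)
qed

text \<open>Expanding the quadratic form of \<open>C\<close> at \<open>e\<^sub>j - C\<^sub>J\<^sup>-\<^sup>1 e\<^sub>j\<close> shows that the diagonal entries of
  \<open>C\<^sub>J\<^sup>-\<^sup>1\<close> are at least \<open>1\<close>.\<close>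

lemma submat_norm_inv_ge_1:
  assumes C: "pos_def_hermitian C" and diag: "\<And>i. C $ i $ i = 1" and "j \<in> J"
  shows "1 \<le> submat_norm J (submat_inv J C)"
proof -
  define A where "A = submat_inv J C"
  have inv: "(\<Sum>k\<in>J. C $ i $ k * A $ k $ j) = (if i = j then 1 else 0)" if "i \<in> J" for i
    using submat_inv_works[OF C, of J] that \<open>j \<in> J\<close> by (auto simp: A_def)
  have sum_J: "(\<Sum>j\<in>UNIV. g j) = (\<Sum>j\<in>J. g j)" if "\<And>j. j \<notin> J \<Longrightarrow> g j = 0" for g :: "'a \<Rightarrow> complex"
    using that by (intro sum.mono_neutral_right) auto
  \<comment> \<open>Extension by zero outside \<open>J\<close> allows the form of the full matrix
    \<open>C\<close> to be used for the block.\<close>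
  define w where "w = (\<chi> i. if i \<in> J then (if i = j then 1 else 0) - A $ i $ j else 0)"
  have w: "w $ i = (if i \<in> J then (if i = j then 1 else 0) - A $ i $ j else 0)" for i
    by (simp add: w_def)
  have Cw: "(C *v w) $ i = C $ i $ j - (if i = j then 1 else 0)" if "i \<in> J" for i
  proof -
    have "(C *v w) $ i = (\<Sum>k\<in>J. C $ i $ k * ((if k = j then 1 else 0) - A $ k $ j))"
      unfolding matrix_vector_mult_def vec_lambda_beta
      by (subst sum_J) (auto simp: w_def intro!: sum.cong)
    also have "\<dots> = (\<Sum>k\<in>J. if k = j then C $ i $ k else 0) - (\<Sum>k\<in>J. C $ i $ k * A $ k $ j)"
      unfolding sum_subtractf[symmetric] by (rule sum.cong) (auto simp: algebra_simps)
    finally show ?thesis using that \<open>j \<in> J\<close> by (simp add: inv)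
  qed
  have herm: "cnj (C $ i $ k) = C $ k $ i" for i k
    by (rule hermitian_mat_cnj[OF pos_def_hermitianD(1)[OF C]])
  have "cvec_inner w (C *v w) = (\<Sum>i\<in>J. ((if i = j then 1 else 0) - A $ i $ j) * cnj (C $ i $ j - (if i = j then 1 else 0)))"
    unfolding cvec_inner_def using Cw w by (subst sum_J) (auto intro!: sum.cong)
  also have "\<dots> = (\<Sum>i\<in>J. (if i = j then C $ j $ j - 1 + A $ j $ j else 0) - C $ j $ i * A $ i $ j)"
    by (rule sum.cong) (auto simp: herm algebra_simps)
  \<comment> \<open>The sum of the products \<open>C $ j $ i * A $ i $ j\<close> is 1 by
    \<open>inv\<close> at \<open>i = j\<close>, and the unit diagonal removes
    \<open>C $ j $ j - 1\<close>.\<close>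
  also have "\<dots> = A $ j $ j - 1"
    using \<open>j \<in> J\<close> by (simp add: sum_subtractf inv diag)
  finally have "1 \<le> Re (A $ j $ j)"
    using pos_def_hermitianD(3)[OF C, of w] by simp
  also have "\<dots> \<le> cmod (A $ j $ j)" by (rule complex_Re_le_cmod)
  also have "\<dots> \<le> submat_norm J A" using \<open>j \<in> J\<close> by (intro cmod_entry_le_submat_norm)
  finally show ?thesis by (simp add: A_def)
qed

lemma submat_norm_ge_1:
  assumes "\<And>i. C $ i $ i = 1" "j \<in> J"
  shows "1 \<le> submat_norm J C"
  using cmod_entry_le_submat_norm[OF assms(2) assms(2), of C] assms(1) by simp

section \<open>Normalization to unit diagonal\<close>

definition normalized_mat :: "complex ^ 'n ^ 'n \<Rightarrow> complex ^ 'n ^ 'n" where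
  "normalized_mat B = (\<chi> i j. B $ i $ j / of_real (sqrt (Re (B $ i $ i) * Re (B $ j $ j))))"

definition diag_scale :: "('n \<Rightarrow> real) \<Rightarrow> complex ^ 'n \<Rightarrow> complex ^ 'n" where
  "diag_scale d v = (\<chi> i. of_real (d i) * v $ i)"

lemma diag_scale_scale [simp]: "diag_scale c (diag_scale d v) = diag_scale (\<lambda>i. c i * d i) v"
  by (simp add: diag_scale_def vec_eq_iff)

lemma diag_scale_1 [simp]: "diag_scale (\<lambda>i. 1) v = v"
  by (simp add: diag_scale_def vec_eq_iff)

lemma cvec_inner_diag_scale: "cvec_inner (diag_scale d u) w = cvec_inner u (diag_scale d w)"
  by (simp add: cvec_inner_def diag_scale_def mult_ac)

lemma cvec_inner_diag_scale_const: "cvec_inner u (diag_scale (\<lambda>_. c) w) = of_real c * cvec_inner u w"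
  by (simp add: cvec_inner_def diag_scale_def sum_distrib_left mult_ac)

lemma matrix_mult_diag_scale_const: "A *v diag_scale (\<lambda>_. c) w = diag_scale (\<lambda>_. c) (A *v w)"
  by (simp add: diag_scale_def matrix_vector_mult_def vec_eq_iff sum_distrib_left mult_ac)

text \<open>The normalized matrix is \<open>D B D\<close> with \<open>D\<close> diagonal, so its
  form is the form of \<open>B\<close> at a rescaled vector.\<close>

lemma normalized_mat_mult:
  "normalized_mat B *v v = diag_scale (\<lambda>i. 1 / sqrt (Re (B $ i $ i)))
     (B *v diag_scale (\<lambda>i. 1 / sqrt (Re (B $ i $ i))) v)"
  by (simp add: vec_eq_iff matrix_vector_mult_def normalized_mat_def diag_scale_def sum_distrib_left
      real_sqrt_mult mult_ac)

context
  fixes B :: "complex ^ 'n ^ 'n"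
  assumes B: "pos_def_hermitian B"
begin

lemma normalized_mat_diag: "normalized_mat B $ i $ i = 1"
proof -
  obtain a where "B $ i $ i = of_real a" "0 < a"
    using pos_def_hermitian_diag[OF B, of i] by blast
  then show ?thesis by (simp add: normalized_mat_def)
qed

lemma Re_diag_ne_0: "Re (B $ i $ i) \<noteq> 0"
  using pos_def_hermitian_diag(1)[OF B, of i] by simp

lemma pos_def_normalized_mat: "pos_def_hermitian (normalized_mat B)"
proof -
  let ?d = "\<lambda>i. 1 / sqrt (Re (B $ i $ i))"
  have "0 < Re (cvec_inner v (normalized_mat B *v v))" if "v \<noteq> 0" for v
  proof -
    from that have "diag_scale ?d v \<noteq> 0"
      using Re_diag_ne_0 by (auto simp: diag_scale_def vec_eq_iff)
    then show ?thesis
      unfolding normalized_mat_mult cvec_inner_diag_scale[symmetric]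
      by (rule pos_def_hermitianD(2)[OF B])
  qed
  moreover have "cnj (B $ i $ j) = B $ j $ i" for i j
    by (rule hermitian_mat_cnj[OF pos_def_hermitianD(1)[OF B]])
  ultimately show ?thesis
    by (simp add: pos_def_hermitian_def hermitian_mat_def normalized_mat_def mult.commute)
qed

text \<open>The inverse of \<open>D B D\<close> is the inverse of \<open>B\<close> multiplied on
  both sides by the inverse of \<open>D\<close>; this moves the inverse form to the normalized
  matrix.\<close>

lemma cvec_inner_inv_normalized:
  fixes z :: "complex ^ 'n"
  defines "w \<equiv> diag_scale (\<lambda>i. 1 / sqrt (Re (B $ i $ i))) z"
  shows "cvec_inner z (matrix_inv B *v z) = cvec_inner w (matrix_inv (normalized_mat B) *v w)"
proof -
  let ?d = "\<lambda>i. 1 / sqrt (Re (B $ i $ i))"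
  have "normalized_mat B *v diag_scale (\<lambda>i. sqrt (Re (B $ i $ i))) (matrix_inv B *v z) = w"
    by (simp add: normalized_mat_mult Re_diag_ne_0 w_def pos_def_hermitian_inv_mult[OF B])
  then have "matrix_inv (normalized_mat B) *v w = diag_scale (\<lambda>i. sqrt (Re (B $ i $ i))) (matrix_inv B *v z)"
    using pos_def_hermitian_inv_mult(2)[OF pos_def_normalized_mat] by metis
  then show ?thesis
    by (simp add: w_def cvec_inner_diag_scale Re_diag_ne_0)
qed

lemma sum_cmod_normalized:
  "(\<Sum>i\<in>UNIV. (cmod (diag_scale (\<lambda>i. 1 / sqrt (Re (B $ i $ i))) z $ i))\<^sup>2)
    = (\<Sum>i\<in>UNIV. (cmod (z $ i))\<^sup>2 / Re (B $ i $ i))"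
  using pos_def_hermitian_diag(1)[OF B]
  by (intro sum.cong) (auto simp: diag_scale_def norm_divide power_divide less_imp_le)

text \<open>This puts a Gaussian weight with independent coordinates below that of \<open>B\<close>;
  it controls the normalizing constant.\<close>

lemma inv_quadratic_le:
  "Re (cvec_inner z (matrix_inv B *v z))
    \<le> onorm ((*v) (matrix_inv (normalized_mat B))) * (\<Sum>i\<in>UNIV. (cmod (z $ i))\<^sup>2 / Re (B $ i $ i))"
  unfolding cvec_inner_inv_normalized sum_cmod_normalized[symmetric] by (rule quadratic_le_onorm)

lemma onorm_normalized_mat_ge_1:
  "1 \<le> onorm ((*v) (normalized_mat B))" "1 \<le> onorm ((*v) (matrix_inv (normalized_mat B)))"
  using submat_norm_ge_1[of "normalized_mat B" undefined UNIV] normalized_mat_diag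
    submat_norm_inv_ge_1[OF pos_def_normalized_mat, of undefined UNIV]
  by (auto simp: submat_norm_UNIV submat_inv_UNIV)

text \<open>Counterpart of \<open>inv_quadratic_le\<close>: independent coordinates dominate the
  density from above. It follows by duality from the norm bound for the normalized form.\<close>

lemma inv_quadratic_ge:
  "(\<Sum>i\<in>UNIV. (cmod (z $ i))\<^sup>2 / Re (B $ i $ i)) / onorm ((*v) (normalized_mat B))
     \<le> Re (cvec_inner z (matrix_inv B *v z))"
proof -
  define n where "n = onorm ((*v) (normalized_mat B))"
  have n: "0 < n" using onorm_normalized_mat_ge_1(1) by (simp add: n_def)
  define w where "w = diag_scale (\<lambda>i. 1 / sqrt (Re (B $ i $ i))) z"
  define S where "S = (\<Sum>i\<in>UNIV. (cmod (w $ i))\<^sup>2)"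
  \<comment> \<open>Once the normalized form is bounded by its norm \<open>n\<close>,
    \<open>inv_quadratic_lower\<close> leaves \<open>2 Re <w, u> - n |u|^2\<close>;
    \<open>u = w / n\<close> maximizes this, with value \<open>S / n\<close>.\<close>
  define u where "u = diag_scale (\<lambda>i. 1 / n) w"
  have "cvec_inner w u = of_real (1 / n) * cvec_inner w w"
    by (simp add: u_def diag_scale_def cvec_inner_def sum_distrib_left mult_ac)
  then have wu: "Re (cvec_inner w u) = S / n"
    using Re_cvec_inner_self[of w] by (simp add: S_def Re_divide_of_real)
  have "Re (cvec_inner u (normalized_mat B *v u)) \<le> n * (\<Sum>i\<in>UNIV. (cmod (u $ i))\<^sup>2)"
    unfolding n_def by (rule quadratic_le_onorm)
  also have "\<dots> = S / n"
    using n by (simp add: u_def diag_scale_def norm_divide power_divide S_def sum_divide_distrib[symmetric] power2_eq_square)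
  finally have "S / n \<le> Re (cvec_inner w (matrix_inv (normalized_mat B) *v w))"
    using inv_quadratic_lower[OF pos_def_normalized_mat, of w u] wu by simp
  then show ?thesis
    unfolding cvec_inner_inv_normalized S_def w_def sum_cmod_normalized n_def .
qed

end

section \<open>Complex Gaussian vectors\<close>

lemma two_cosh_minus_two_le: "exp x + exp (- x) - 2 \<le> x\<^sup>2 * exp \<bar>x :: real\<bar>"
proof -
  \<comment> \<open>The left side of the claim is the square of
    \<open>exp (y / 2) - exp (- y / 2)\<close>, a difference controlled by
    \<open>1 - y \<le> exp (- y)\<close>.\<close>
  have "(exp (y / 2) - exp (- y / 2))\<^sup>2 \<le> (y * exp (y / 2))\<^sup>2" if "0 \<le> y" for y :: real
  proof (rule power_mono)
    have "(1 - y) * exp (y / 2) \<le> exp (- y) * exp (y / 2)"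
      using exp_ge_add_one_self[of "- y"] by (intro mult_right_mono) auto
    then show "exp (y / 2) - exp (- y / 2) \<le> y * exp (y / 2)"
      by (simp add: exp_add[symmetric] algebra_simps)
  qed (use that in simp)
  moreover have "(exp (y / 2) - exp (- y / 2))\<^sup>2 = exp y + exp (- y) - 2" for y :: real
    by (simp add: power2_diff exp_double[symmetric] mult.assoc exp_add[symmetric])
  moreover have "(y * exp (y / 2))\<^sup>2 = y\<^sup>2 * exp y" for y :: real
    by (simp add: power_mult_distrib exp_double[symmetric])
  ultimately have "exp y + exp (- y) - 2 \<le> y\<^sup>2 * exp y" if "0 \<le> y" for y :: real
    using that by metis
  from this[of x] this[of "- x"] show ?thesis by (cases "0 \<le> x") (auto simp: add.commute)
qed

text \<open>The second moment is the limit of symmetric second difference quotients of the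
  generating function at 0. Dominated convergence with steps \<open>1 / Suc n\<close> replaces
  differentiation under the integral.\<close>

lemma (in prob_space) second_moment_of_mgf:
  fixes R :: "'a \<Rightarrow> real"
  assumes [measurable]: "R \<in> borel_measurable M"
    and mgf: "\<And>s. (\<integral>\<^sup>+\<omega>. ennreal (exp (s * R \<omega>)) \<partial>M) = ennreal (exp (s\<^sup>2 * \<sigma>))"
  shows "integrable M (\<lambda>\<omega>. (R \<omega>)\<^sup>2)" "(LINT \<omega>|M. (R \<omega>)\<^sup>2) = 2 * \<sigma>"
proof -
  have "has_bochner_integral M (\<lambda>\<omega>. exp (s * R \<omega>)) (exp (s\<^sup>2 * \<sigma>))" for s
    by (rule has_bochner_integral_nn_integral) (auto simp: mgf)
  then have int: "integrable M (\<lambda>\<omega>. exp (s * R \<omega>))" "(LINT \<omega>|M. exp (s * R \<omega>)) = exp (s\<^sup>2 * \<sigma>)" for s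
    by (auto simp: has_bochner_integral_iff)
  define f where "f n \<omega> = (exp (1 / real (Suc n) * R \<omega>) + exp (- (1 / real (Suc n)) * R \<omega>) - 2) * (real (Suc n))\<^sup>2" for n \<omega>
  have lim: "(\<lambda>n. f n \<omega>) \<longlonglongrightarrow> (R \<omega>)\<^sup>2" for \<omega>
  proof -
    have "(\<lambda>n. (exp (1 / real (Suc n) * r) + exp (- (1 / real (Suc n)) * r) - 2) * (real (Suc n))\<^sup>2) \<longlonglongrightarrow> r\<^sup>2" for r :: real
    proof -
      consider "r = 0" | "r > 0" | "r < 0" by linarith
      then show ?thesis by cases (simp, (real_asymp simp: power2_eq_square)+)
    qed
    then show ?thesis unfolding f_def .
  qed
  \<comment> \<open>Steps \<open>s \<le> 1\<close> make the bound uniform: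
    \<open>two_cosh_minus_two_le\<close> gives \<open>R^2 exp |R|\<close>, then
    \<open>R^2 \<le> 2 exp |R|\<close>, and the two exponentials cover both signs of
    \<open>R\<close>.\<close>
  have bound: "norm (f n \<omega>) \<le> 2 * (exp (2 * R \<omega>) + exp (- 2 * R \<omega>))" for n \<omega>
  proof -
    define s where "s = 1 / real (Suc n)"
    have s: "0 < s" "s \<le> 1" by (auto simp: s_def)
    have f: "f n \<omega> = (exp (s * R \<omega>) + exp (- (s * R \<omega>)) - 2) / s\<^sup>2"
      by (simp add: f_def s_def power_divide)
    have "0 \<le> (exp (y / 2) - exp (- y / 2))\<^sup>2" for y :: real by simp
    then have "0 \<le> exp y + exp (- y) - 2" for y :: real
      by (simp add: power2_diff exp_double[symmetric] mult.assoc exp_add[symmetric])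
    then have "norm (f n \<omega>) = f n \<omega>" by (simp add: f)
    also have "\<dots> \<le> (s * R \<omega>)\<^sup>2 * exp \<bar>s * R \<omega>\<bar> / s\<^sup>2"
      unfolding f by (intro divide_right_mono two_cosh_minus_two_le) simp
    also have "\<dots> = (R \<omega>)\<^sup>2 * exp (s * \<bar>R \<omega>\<bar>)"
      using s by (simp add: power_mult_distrib abs_mult)
    also have "\<dots> \<le> (2 * exp \<bar>R \<omega>\<bar>) * exp \<bar>R \<omega>\<bar>"
      using s exp_lower_Taylor_quadratic[of "\<bar>R \<omega>\<bar>"]
      by (intro mult_mono) (auto intro: mult_left_le_one_le)
    also have "\<dots> = 2 * exp (2 * \<bar>R \<omega>\<bar>)" by (simp add: exp_double power2_eq_square)
    also have "\<dots> \<le> 2 * (exp (2 * R \<omega>) + exp (- 2 * R \<omega>))"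
      by (cases "0 \<le> R \<omega>") auto
    finally show ?thesis .
  qed
  have "integrable M (\<lambda>\<omega>. 2 * (exp (2 * R \<omega>) + exp (- 2 * R \<omega>)))"
    by (intro integrable_mult_right Bochner_Integration.integrable_add int(1))
  have [measurable]: "f n \<in> borel_measurable M" for n unfolding f_def by measurable
  note dom = integrable_dominated_convergence[OF _ _ \<open>integrable M (\<lambda>\<omega>. 2 * (exp (2 * R \<omega>) + exp (- 2 * R \<omega>)))\<close>, of "\<lambda>\<omega>. (R \<omega>)\<^sup>2" f]
     integral_dominated_convergence[OF _ _ \<open>integrable M (\<lambda>\<omega>. 2 * (exp (2 * R \<omega>) + exp (- 2 * R \<omega>)))\<close>, of "\<lambda>\<omega>. (R \<omega>)\<^sup>2" f]
  show "integrable M (\<lambda>\<omega>. (R \<omega>)\<^sup>2)" by (rule dom) (use lim bound in auto)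
  have "(\<lambda>n. LINT \<omega>|M. f n \<omega>) \<longlonglongrightarrow> (LINT \<omega>|M. (R \<omega>)\<^sup>2)" by (rule dom) (use lim bound in auto)
  moreover have "(LINT \<omega>|M. f n \<omega>) = (2 * exp ((1 / real (Suc n))\<^sup>2 * \<sigma>) - 2) * (real (Suc n))\<^sup>2" for n
    unfolding f_def by (simp only: integral_mult_left_zero Bochner_Integration.integral_diff
       Bochner_Integration.integral_add integrable_const int Bochner_Integration.integrable_add lebesgue_integral_const) (simp add: prob_space)
  moreover have "(\<lambda>n. (2 * exp ((1 / real (Suc n))\<^sup>2 * \<sigma>) - 2) * (real (Suc n))\<^sup>2) \<longlonglongrightarrow> 2 * \<sigma>"
  proof -
    consider "\<sigma> = 0" | "\<sigma> > 0" | "\<sigma> < 0" by linarith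
    then show ?thesis by cases (simp, real_asymp+)
  qed
  ultimately show "(LINT \<omega>|M. (R \<omega>)\<^sup>2) = 2 * \<sigma>"
    by (simp only: LIMSEQ_unique)
qed

lemma borel_measurable_cnj [measurable (raw)]:
  "f \<in> borel_measurable M \<Longrightarrow> (\<lambda>x. cnj (f x)) \<in> borel_measurable M"
  by (rule borel_measurable_continuous_on[OF continuous_on_cnj[OF continuous_on_id]])

lemma measurable_cvec_inner [measurable (raw)]:
  assumes [measurable]: "f \<in> borel_measurable M" "g \<in> borel_measurable M"
  shows "(\<lambda>x. cvec_inner (f x) (g x)) \<in> borel_measurable M"
  unfolding cvec_inner_def by measurable

section \<open>Moments of a complex Gaussian vector\<close>

locale complex_gaussian_vector = prob_space M for M :: "'a measure" +
  fixes X :: "'a \<Rightarrow> complex ^ 'n" and B :: "complex ^ 'n ^ 'n"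
  assumes gaussian: "complex_gaussian M X B"
begin

lemma pos_def: "pos_def_hermitian B"
  using gaussian by (simp add: complex_gaussian_def)

lemma distr_X: "distributed M lborel X (\<lambda>z. ennreal (complex_gaussian_density B z))"
  using gaussian by (simp add: complex_gaussian_def)

lemma measurable_X [measurable]: "X \<in> borel_measurable M"
  using distributed_measurable[OF distr_X] by simp

lemma measurable_density [measurable]: "(\<lambda>z. ennreal (complex_gaussian_density B z)) \<in> borel_measurable borel"
  using distributed_borel_measurable[OF distr_X] by simp

text \<open>The total mass is 1 because the density is that of a random vector on a probability
  space; no integral with a determinant is evaluated.\<close>

lemma nn_integral_density_1: "(\<integral>\<^sup>+z. ennreal (complex_gaussian_density B z) \<partial>lborel) = 1"
  using distributed_nn_integral[OF distr_X, of "\<lambda>_. 1"] by (simp add: emeasure_space_1)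

text \<open>Tilting the density by this exponential translates it by \<open>B *v u\<close>, up to a
  constant factor; the 2 is the one of the completed square.\<close>

lemma mgf: "(\<integral>\<^sup>+\<omega>. ennreal (exp (2 * Re (cvec_inner (X \<omega>) u))) \<partial>M) = ennreal (exp (Re (cvec_inner u (B *v u))))"
proof -
  define c where "c = B *v u"
  have eq: "complex_gaussian_density B z * exp (2 * Re (cvec_inner z u))
      = exp (Re (cvec_inner u c)) * complex_gaussian_density B (- c + z)" for z
    using inv_complete_square[OF pos_def, of "- c + z" u]
    by (simp add: complex_gaussian_density_def c_def[symmetric] cvec_inner_diff_left
        exp_add[symmetric] Re_cvec_inner_commute[of c u])
  have "(\<integral>\<^sup>+\<omega>. ennreal (exp (2 * Re (cvec_inner (X \<omega>) u))) \<partial>M)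
     = (\<integral>\<^sup>+z. ennreal (complex_gaussian_density B z) * ennreal (exp (2 * Re (cvec_inner z u))) \<partial>lborel)"
    by (rule distributed_nn_integral[OF distr_X, symmetric]) measurable
  also have "\<dots> = (\<integral>\<^sup>+z. ennreal (exp (Re (cvec_inner u c))) * ennreal (complex_gaussian_density B (- c + z)) \<partial>lborel)"
    by (simp add: ennreal_mult'[symmetric] ennreal_mult''[symmetric] eq)
  also have "\<dots> = ennreal (exp (Re (cvec_inner u c))) * (\<integral>\<^sup>+z. ennreal (complex_gaussian_density B (- c + z)) \<partial>lborel)"
    by (rule nn_integral_cmult) measurable
  also have "(\<integral>\<^sup>+z. ennreal (complex_gaussian_density B (- c + z)) \<partial>lborel)
    = (\<integral>\<^sup>+z. ennreal (complex_gaussian_density B z) \<partial>distr lborel borel ((+) (- c)))"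
    by (rule nn_integral_distr[symmetric]) measurable
  finally show ?thesis
    by (simp add: lborel_distr_plus nn_integral_density_1 c_def)
qed

lemma Re_second_moment:
  "integrable M (\<lambda>\<omega>. (Re (cvec_inner (X \<omega>) u))\<^sup>2)"
  "(LINT \<omega>|M. (Re (cvec_inner (X \<omega>) u))\<^sup>2) = Re (cvec_inner u (B *v u)) / 2"
proof -
  define R where "R = (\<lambda>\<omega>. 2 * Re (cvec_inner (X \<omega>) u))"
  have "(\<integral>\<^sup>+\<omega>. ennreal (exp (s * R \<omega>)) \<partial>M) = ennreal (exp (s\<^sup>2 * Re (cvec_inner u (B *v u))))" for s
    \<comment> \<open>A real multiple \<open>s\<close> of \<open>u\<close> scales the exponent by
      the square of \<open>s\<close>, the form that \<open>second_moment_of_mgf\<close>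
      requires.\<close>
    using mgf[of "diag_scale (\<lambda>_. s) u"]
    by (simp add: R_def power2_eq_square mult_ac cvec_inner_diag_scale cvec_inner_diag_scale_const
        matrix_mult_diag_scale_const)
  then have "integrable M (\<lambda>\<omega>. (R \<omega>)\<^sup>2)" "(LINT \<omega>|M. (R \<omega>)\<^sup>2) = 2 * Re (cvec_inner u (B *v u))"
    by (rule second_moment_of_mgf[rotated]; simp add: R_def)+
  then show "integrable M (\<lambda>\<omega>. (Re (cvec_inner (X \<omega>) u))\<^sup>2)"
     "(LINT \<omega>|M. (Re (cvec_inner (X \<omega>) u))\<^sup>2) = Re (cvec_inner u (B *v u)) / 2"
    by (simp_all add: R_def power_mult_distrib)
qed

text \<open>Polarization of \<open>Re_second_moment\<close>; Hermitian symmetry identifies the two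
  mixed terms.\<close>

lemma Re_covariance:
  "has_bochner_integral M (\<lambda>\<omega>. Re (cvec_inner (X \<omega>) u) * Re (cvec_inner (X \<omega>) v)) (Re (cvec_inner u (B *v v)) / 2)"
proof -
  let ?Q = "\<lambda>u \<omega>. (Re (cvec_inner (X \<omega>) u))\<^sup>2"
  have Q: "has_bochner_integral M (?Q u) (Re (cvec_inner u (B *v u)) / 2)" for u
    using Re_second_moment[of u] by (simp add: has_bochner_integral_iff)
  have "has_bochner_integral M (\<lambda>\<omega>. (?Q (u + v) \<omega> - ?Q u \<omega> - ?Q v \<omega>) / 2)
    ((Re (cvec_inner (u + v) (B *v (u + v))) / 2 - Re (cvec_inner u (B *v u)) / 2 - Re (cvec_inner v (B *v v)) / 2) / 2)"
    by (intro has_bochner_integral_divide_zero has_bochner_integral_diff Q)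
  moreover have "(?Q (u + v) \<omega> - ?Q u \<omega> - ?Q v \<omega>) / 2 = Re (cvec_inner (X \<omega>) u) * Re (cvec_inner (X \<omega>) v)" for \<omega>
    by (simp add: cvec_inner_add_right power2_sum)
  moreover have "Re (cvec_inner v (B *v u)) = Re (cvec_inner u (B *v v))"
    using cvec_inner_hermitian[OF pos_def_hermitianD(1)[OF pos_def], of u v] Re_cvec_inner_commute[of v "B *v u"]
    by simp
  ultimately show ?thesis
    by (simp add: matrix_vector_right_distrib cvec_inner_add_left cvec_inner_add_right field_simps)
qed

lemma covariance: "has_bochner_integral M (\<lambda>\<omega>. X \<omega> $ i * cnj (X \<omega> $ j)) (B $ i $ j)"
proof -
  have sum1: "(\<Sum>k\<in>UNIV. f k * (if k = i then c else 0)) = f i * c" 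
    "(\<Sum>k\<in>UNIV. (if k = i then c else 0) * f k) = c * f i" for f :: "'n \<Rightarrow> complex" and c i
    by (simp_all add: if_distrib[of "\<lambda>a. _ * a"] if_distrib[of "\<lambda>a. a * _"] cong: if_cong)
  have cnj_if: "cnj (if b then c else 0) = (if b then cnj c else 0)" for b c by simp
  have ax: "cvec_inner z (axis i c) = z $ i * cnj c" "cvec_inner (axis i c) z = c * cnj (z $ i)"
      "(B *v axis j c) $ i = B $ i $ j * c" for z c i j
    by (simp_all add: cvec_inner_def axis_def matrix_vector_mult_def sum1 cnj_if if_distrib[of cnj] del: complex_cnj_mult cong: if_cong)
  let ?h = "has_bochner_integral M"
  \<comment> \<open>As \<open>cvec_inner\<close> is conjugate linear on the right, testing with
    \<open>axis i 1\<close> and \<open>axis i \<i>\<close> yields the real and imaginary parts of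
    \<open>X \<omega> $ i\<close>.\<close>
  have rr: "?h (\<lambda>\<omega>. Re (X \<omega> $ i) * Re (X \<omega> $ j)) (Re (B $ i $ j) / 2)"
    using Re_covariance[of "axis i 1" "axis j 1"] by (simp add: ax)
  have ii: "?h (\<lambda>\<omega>. Im (X \<omega> $ i) * Im (X \<omega> $ j)) (Re (B $ i $ j) / 2)"
    using Re_covariance[of "axis i \<i>" "axis j \<i>"] by (simp add: ax)
  have ir: "?h (\<lambda>\<omega>. Im (X \<omega> $ i) * Re (X \<omega> $ j)) (Im (B $ i $ j) / 2)"
    using Re_covariance[of "axis i \<i>" "axis j 1"] by (simp add: ax)
  have ri: "?h (\<lambda>\<omega>. Re (X \<omega> $ i) * Im (X \<omega> $ j)) (- Im (B $ i $ j) / 2)"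
    using Re_covariance[of "axis i 1" "axis j \<i>"] by (simp add: ax)
  have "?h (\<lambda>\<omega>. of_real (Re (X \<omega> $ i) * Re (X \<omega> $ j) + Im (X \<omega> $ i) * Im (X \<omega> $ j))
      + \<i> * of_real (Im (X \<omega> $ i) * Re (X \<omega> $ j) - Re (X \<omega> $ i) * Im (X \<omega> $ j)))
    (of_real (Re (B $ i $ j) / 2 + Re (B $ i $ j) / 2) + \<i> * of_real (Im (B $ i $ j) / 2 - (- Im (B $ i $ j) / 2)))"
    by (intro has_bochner_integral_add has_bochner_integral_mult_right has_bochner_integral_of_real
        has_bochner_integral_diff rr ii ir ri)
  moreover have "of_real (Re (X \<omega> $ i) * Re (X \<omega> $ j) + Im (X \<omega> $ i) * Im (X \<omega> $ j))
      + \<i> * of_real (Im (X \<omega> $ i) * Re (X \<omega> $ j) - Re (X \<omega> $ i) * Im (X \<omega> $ j)) = X \<omega> $ i * cnj (X \<omega> $ j)" for \<omega>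
    by (simp add: complex_eq_iff)
  moreover have "of_real (Re (B $ i $ j) / 2 + Re (B $ i $ j) / 2) + \<i> * of_real (Im (B $ i $ j) / 2 - (- Im (B $ i $ j) / 2)) = B $ i $ j"
    by (simp add: complex_eq_iff)
  ultimately show ?thesis by (simp only:)
qed

lemma variance: "has_bochner_integral M (\<lambda>\<omega>. (cmod (X \<omega> $ i))\<^sup>2) (Re (B $ i $ i))"
  using has_bochner_integral_Re[OF covariance[of i i]] by (simp add: complex_norm_square[symmetric] del: of_real_power)

lemma ccov_X: "ccov M (\<lambda>\<omega>. X \<omega> $ i) (\<lambda>\<omega>. X \<omega> $ j) = B $ i $ j"
  using covariance[of i j] by (simp add: ccov_def has_bochner_integral_iff)

lemma cvar_X: "cvar M (\<lambda>\<omega>. X \<omega> $ i) = Re (B $ i $ i)"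
  using variance[of i] by (simp add: cvar_def has_bochner_integral_iff)

lemma correlation_mat_X: "correlation_mat M X = normalized_mat B"
  by (simp add: correlation_mat_def normalized_mat_def ccov_X cvar_X)

section \<open>Comparison with independent Gaussian coordinates\<close>

lemma Re_diag_pos: "0 < Re (B $ i $ i)"
  by (rule pos_def_hermitian_diag(1)[OF pos_def])

text \<open>Otherwise the density would be nonpositive (division by zero gives 0), hence 0 in
  \<open>ennreal\<close>, against total mass 1.\<close>

lemma Re_det_pos: "0 < Re (det B)"
proof (rule ccontr)
  assume "\<not> 0 < Re (det B)"
  then have "ennreal (complex_gaussian_density B z) = 0" for z
    by (simp add: complex_gaussian_density_def divide_nonneg_nonpos ennreal_neg mult_nonneg_nonpos)
  with nn_integral_density_1 show False by simp
qed

text \<open>\<open>inv_quadratic_le\<close> is integrated: the product weight with variances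
  \<open>Re (B $ i $ i) / n\<close> lies below \<open>\<kappa>\<close> times the density, whose
  total mass is 1.\<close>

lemma normalization_le:
  "pi ^ CARD('n) * (\<Prod>i\<in>UNIV. Re (B $ i $ i))
     \<le> pi ^ CARD('n) * Re (det B) * onorm ((*v) (matrix_inv (normalized_mat B))) ^ CARD('n)"
proof -
  define \<kappa> where "\<kappa> = pi ^ CARD('n) * Re (det B)"
  define n where "n = onorm ((*v) (matrix_inv (normalized_mat B)))"
  have n: "0 < n" using onorm_normalized_mat_ge_1(2)[OF pos_def] by (simp add: n_def)
  have \<kappa>: "0 < \<kappa>" using Re_det_pos by (simp add: \<kappa>_def)
  have "ennreal (\<Prod>i\<in>UNIV. pi * (Re (B $ i $ i) / n)) = (\<Prod>i\<in>UNIV. ennreal (pi * (Re (B $ i $ i) / n)))"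
    using n Re_diag_pos by (intro prod_ennreal[symmetric]) (auto simp: less_imp_le)
  also have "\<dots> = (\<Prod>i\<in>UNIV. \<integral>\<^sup>+w. ennreal (exp (- (cmod w)\<^sup>2 / (Re (B $ i $ i) / n))) \<partial>lborel)"
    using n Re_diag_pos by (intro prod.cong refl nn_integral_complex_gaussian[symmetric]) auto
  also have "\<dots> = (\<integral>\<^sup>+z. (\<Prod>i\<in>UNIV. ennreal (exp (- (cmod (z $ i))\<^sup>2 / (Re (B $ i $ i) / n)))) \<partial>lborel)"
    by (rule nn_integral_lborel_vec_prod[symmetric]) measurable
  also have "\<dots> \<le> (\<integral>\<^sup>+z. ennreal \<kappa> * ennreal (complex_gaussian_density B z) \<partial>lborel)"
  proof (rule nn_integral_mono)
    fix z :: "complex ^ 'n"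
    have "(\<Prod>i\<in>UNIV. ennreal (exp (- (cmod (z $ i))\<^sup>2 / (Re (B $ i $ i) / n))))
      = ennreal (exp (- (n * (\<Sum>i\<in>UNIV. (cmod (z $ i))\<^sup>2 / Re (B $ i $ i)))))"
      by (simp add: prod_ennreal exp_sum[symmetric] sum_negf sum_distrib_left mult_ac)
    also have "\<dots> \<le> ennreal (exp (- Re (cvec_inner z (matrix_inv B *v z))))"
      using inv_quadratic_le[OF pos_def, of z] by (simp add: n_def)
    also have "\<dots> = ennreal \<kappa> * ennreal (complex_gaussian_density B z)"
      using \<kappa> by (simp add: complex_gaussian_density_def \<kappa>_def[symmetric] ennreal_mult'[symmetric])
    finally show "(\<Prod>i\<in>UNIV. ennreal (exp (- (cmod (z $ i))\<^sup>2 / (Re (B $ i $ i) / n))))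
      \<le> ennreal \<kappa> * ennreal (complex_gaussian_density B z)" .
  qed
  also have "\<dots> = ennreal \<kappa>"
    by (subst nn_integral_cmult) (simp_all add: nn_integral_density_1)
  finally have "(\<Prod>i\<in>UNIV. pi * (Re (B $ i $ i) / n)) \<le> \<kappa>"
    using \<kappa> by simp
  then show ?thesis
    using n unfolding n_def[symmetric] \<kappa>_def[symmetric]
    by (simp add: prod.distrib prod_dividef divide_le_eq)
qed

text \<open>By \<open>inv_quadratic_ge\<close> a product with variances
  \<open>n * Re (B $ i $ i)\<close> dominates the density up to its constant. The thresholds scale
  with the variances, so every coordinate gives the same \<open>\<mu>\<close> or
  \<open>1 - \<mu>\<close>. One norm comes from this product, the other from
  \<open>normalization_le\<close>.\<close>

lemma prob_small_coordinates:
  fixes x :: real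
  defines "n \<equiv> onorm ((*v) (normalized_mat B))"
  defines "\<mu> \<equiv> 1 - exp (- (x\<^sup>2 / n))"
  shows "prob {\<omega> \<in> space M. \<forall>i. (cmod (X \<omega> $ i))\<^sup>2 < x\<^sup>2 * Re (B $ i $ i) \<longleftrightarrow> i \<in> K}
     \<le> (n * onorm ((*v) (matrix_inv (normalized_mat B)))) ^ CARD('n)
        * (\<mu> ^ card K * (1 - \<mu>) ^ card (- K))"
proof -
  define m where "m = onorm ((*v) (matrix_inv (normalized_mat B)))"
  define \<kappa> where "\<kappa> = pi ^ CARD('n) * Re (det B)"
  have n: "1 \<le> n" using onorm_normalized_mat_ge_1(1)[OF pos_def] by (simp add: n_def)
  have \<kappa>: "0 < \<kappa>" using Re_det_pos by (simp add: \<kappa>_def)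
  have \<mu>: "0 \<le> \<mu>" "0 \<le> 1 - \<mu>" using n by (auto simp: \<mu>_def)
  let ?b = "\<lambda>i. Re (B $ i $ i)"
  have b: "0 < ?b i" "0 \<le> ?b i" "?b i \<noteq> 0" for i using Re_diag_pos[of i] by auto
  define S :: "(complex ^ 'n) set" where
    "S = {z. \<forall>i. (cmod (z $ i))\<^sup>2 < x\<^sup>2 * ?b i \<longleftrightarrow> i \<in> K}"
  have [measurable]: "S \<in> sets borel" unfolding S_def by measurable
  define f where "f = (\<lambda>i w. ennreal (exp (- (cmod w)\<^sup>2 / (n * ?b i))) *
     indicator (if i \<in> K then {w. (cmod w)\<^sup>2 < x\<^sup>2 * ?b i} else {w. x\<^sup>2 * ?b i \<le> (cmod w)\<^sup>2}) w)"
  have f_meas [measurable]: "f i \<in> borel_measurable borel" for i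
    by (cases "i \<in> K") (simp_all add: f_def)
  have f_int: "(\<integral>\<^sup>+w. f i w \<partial>lborel) = ennreal (pi * (n * ?b i) * (if i \<in> K then \<mu> else 1 - \<mu>))" for i
  proof -
    have "0 < n * ?b i" "0 \<le> x\<^sup>2 * ?b i" using n b[of i] by auto
    moreover have "- (x\<^sup>2 * ?b i) / (n * ?b i) = - (x\<^sup>2 / n)" using b[of i] by simp
    ultimately show ?thesis
      using nn_integral_complex_gaussian_disc[of "n * ?b i" "x\<^sup>2 * ?b i"]
        nn_integral_complex_gaussian_tail[of "n * ?b i" "x\<^sup>2 * ?b i"]
      by (cases "i \<in> K") (simp_all only: f_def \<mu>_def if_True if_False simp_thms diff_diff_eq2 add_diff_cancel_left' diff_add_cancel)
  qed
  have "ennreal \<kappa> * emeasure M {\<omega> \<in> space M. X \<omega> \<in> S} = ennreal \<kappa> * (\<integral>\<^sup>+z. ennreal (complex_gaussian_density B z) * indicator S z \<partial>lborel)"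
    using distributed_emeasure[OF distr_X, of S] by (simp add: vimage_def Int_def conj_commute)
  also have "\<dots> = (\<integral>\<^sup>+z. ennreal \<kappa> * (ennreal (complex_gaussian_density B z) * indicator S z) \<partial>lborel)"
    by (rule nn_integral_cmult[symmetric]) measurable
  also have "\<dots> \<le> (\<integral>\<^sup>+z. (\<Prod>i\<in>UNIV. f i (z $ i)) \<partial>lborel)"
  proof (rule nn_integral_mono)
    fix z :: "complex ^ 'n"
    show "ennreal \<kappa> * (ennreal (complex_gaussian_density B z) * indicator S z) \<le> (\<Prod>i\<in>UNIV. f i (z $ i))"
    proof (cases "z \<in> S")
      case True
      have "ennreal \<kappa> * ennreal (complex_gaussian_density B z) = ennreal (exp (- Re (cvec_inner z (matrix_inv B *v z))))"
        using \<kappa> by (simp add: complex_gaussian_density_def \<kappa>_def[symmetric] ennreal_mult'[symmetric])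
      also have "\<dots> \<le> ennreal (exp (- ((\<Sum>i\<in>UNIV. (cmod (z $ i))\<^sup>2 / ?b i) / n)))"
        using inv_quadratic_ge[OF pos_def, of z] by (simp add: n_def)
      also have "\<dots> = (\<Prod>i\<in>UNIV. ennreal (exp (- (cmod (z $ i))\<^sup>2 / (n * ?b i))))"
        by (simp add: prod_ennreal exp_sum[symmetric] sum_negf sum_divide_distrib mult_ac)
      also have "\<dots> = (\<Prod>i\<in>UNIV. f i (z $ i))"
        using True by (intro prod.cong) (auto simp: f_def S_def indicator_def not_less[symmetric])
      finally show ?thesis using True by simp
    qed simp
  qed
  also have "\<dots> = (\<Prod>i\<in>UNIV. ennreal (pi * (n * ?b i) * (if i \<in> K then \<mu> else 1 - \<mu>)))"
    by (simp add: nn_integral_lborel_vec_prod f_int)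
  also have "\<dots> = ennreal (\<Prod>i\<in>UNIV. pi * (n * ?b i) * (if i \<in> K then \<mu> else 1 - \<mu>))"
    using n b \<mu> by (intro prod_ennreal) auto
  finally have "\<kappa> * prob {\<omega> \<in> space M. X \<omega> \<in> S} \<le> (\<Prod>i\<in>UNIV. pi * (n * ?b i) * (if i \<in> K then \<mu> else 1 - \<mu>))"
    using \<kappa> n b \<mu> by (simp add: emeasure_eq_measure ennreal_mult'[symmetric] prod_nonneg ennreal_le_iff)
  also have "\<dots> = n ^ CARD('n) * (pi ^ CARD('n) * (\<Prod>i\<in>UNIV. ?b i)) * (\<Prod>i\<in>UNIV. if i \<in> K then \<mu> else 1 - \<mu>)"
    by (simp add: prod.distrib)
  also have "(\<Prod>i\<in>UNIV. if i \<in> K then \<mu> else 1 - \<mu>) = \<mu> ^ card K * (1 - \<mu>) ^ card (- K)"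
    by (simp add: prod.If_cases)
  \<comment> \<open>The product of the variances is traded for \<open>\<kappa>\<close>, which then
    cancels.\<close>
  also have "n ^ CARD('n) * (pi ^ CARD('n) * (\<Prod>i\<in>UNIV. ?b i)) * (\<mu> ^ card K * (1 - \<mu>) ^ card (- K))
    \<le> n ^ CARD('n) * (\<kappa> * m ^ CARD('n)) * (\<mu> ^ card K * (1 - \<mu>) ^ card (- K))"
    using n \<mu> normalization_le by (intro mult_right_mono mult_left_mono) (auto simp: \<kappa>_def m_def)
  finally have "\<kappa> * prob {\<omega> \<in> space M. X \<omega> \<in> S} \<le> \<kappa> * ((n * m) ^ CARD('n) * (\<mu> ^ card K * (1 - \<mu>) ^ card (- K)))"
    by (simp add: power_mult_distrib mult_ac)
  then show ?thesis
    using \<kappa> by (simp add: S_def m_def)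
qed

text \<open>Linearizing \<open>exp (\<theta>|w|\<^sup>2)\<close> as a Gaussian average of \<open>exp (2 \<surd>\<theta> Re \<langle>w, g\<rangle>)\<close> reduces this to
  the moment generating function, so no determinant or spectrum of the submatrix is needed.\<close>

lemma exponential_moment:
  assumes \<theta>: "0 \<le> \<theta>" "\<theta> * submat_norm J (normalized_mat B) < 1"
  shows "(\<integral>\<^sup>+\<omega>. ennreal (exp (\<theta> * (\<Sum>i\<in>J. (cmod (X \<omega> $ i))\<^sup>2 / Re (B $ i $ i)))) \<partial>M)
    \<le> ennreal ((1 / (1 - \<theta> * submat_norm J (normalized_mat B))) ^ card J)"
proof -
  define n where "n = submat_norm J (normalized_mat B)"
  let ?b = "\<lambda>i. Re (B $ i $ i)"
  have b: "0 < ?b i" "0 \<le> ?b i" "?b i \<noteq> 0" for i using Re_diag_pos[of i] by auto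
  define v :: "complex ^ 'n \<Rightarrow> complex ^ 'n" where
    "v g = (\<chi> i. if i \<in> J then of_real (sqrt \<theta>) * g $ i else 0)" for g
  define d where "d = (\<lambda>i. 1 / sqrt (?b i))"
  \<comment> \<open>The auxiliary \<open>g\<close> carries an unnormalized Gaussian weight. As
    \<open>v\<close> cuts \<open>g\<close> to \<open>J\<close>, its coordinates outside
    \<open>J\<close> enter only through this weight.\<close>
  define G where "G \<omega> g = ennreal (exp (2 * Re (cvec_inner (X \<omega>) (diag_scale d (v g)))))
     * ennreal (exp (- (\<Sum>i\<in>UNIV. (cmod (g $ i))\<^sup>2)))" for \<omega> g
  have [measurable]: "(\<lambda>g. diag_scale d (v g)) \<in> borel_measurable borel"
  proof -
    have "continuous_on UNIV (\<lambda>g. diag_scale d (v g))"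
      unfolding diag_scale_def v_def
      by (intro continuous_on_vec_lambda, rename_tac i, case_tac "i \<in> J") (auto intro!: continuous_intros)
    then show ?thesis by (rule borel_measurable_continuous_onI)
  qed
  have G_meas: "(\<lambda>(\<omega>, g). G \<omega> g) \<in> borel_measurable (M \<Otimes>\<^sub>M lborel)"
    unfolding G_def by measurable
  interpret pair_sigma_finite M "lborel :: (complex ^ 'n) measure" ..
  have int_g: "(\<integral>\<^sup>+g. G \<omega> g \<partial>lborel) = ennreal (pi ^ CARD('n)) * ennreal (exp (\<theta> * (\<Sum>i\<in>J. (cmod (X \<omega> $ i))\<^sup>2 / ?b i)))" for \<omega>
  proof -
    define w where "w i = (if i \<in> J then of_real (sqrt \<theta> * d i) * X \<omega> $ i else 0)" for i
    have "G \<omega> g = (\<Prod>i\<in>UNIV. ennreal (exp (2 * Re (w i * cnj (g $ i)) - (cmod (g $ i))\<^sup>2)))" for g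
    proof -
      have "cvec_inner (X \<omega>) (diag_scale d (v g)) = (\<Sum>i\<in>UNIV. w i * cnj (g $ i))"
        unfolding cvec_inner_def by (rule sum.cong) (auto simp: diag_scale_def v_def w_def)
      then show ?thesis
        by (simp add: G_def prod_ennreal exp_sum[symmetric] sum_subtractf sum_distrib_left
            ennreal_mult'[symmetric] exp_add[symmetric])
    qed
    then have "(\<integral>\<^sup>+g. G \<omega> g \<partial>lborel)
      = (\<integral>\<^sup>+g. (\<Prod>i\<in>UNIV. ennreal (exp (2 * Re (w i * cnj (g $ i)) - (cmod (g $ i))\<^sup>2))) \<partial>lborel)"
      by (simp only:)
    also have "\<dots> = (\<Prod>i\<in>UNIV. \<integral>\<^sup>+g. ennreal (exp (2 * Re (w i * cnj g) - (cmod g)\<^sup>2)) \<partial>lborel)"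
      by (rule nn_integral_lborel_vec_prod) measurable
    also have "\<dots> = (\<Prod>i\<in>UNIV. ennreal (pi * exp ((cmod (w i))\<^sup>2)))"
      by (simp only: nn_integral_complex_gaussian_shift)
    also have "\<dots> = ennreal (pi ^ CARD('n) * exp (\<Sum>i\<in>UNIV. (cmod (w i))\<^sup>2))"
      by (subst prod_ennreal) (auto simp: prod.distrib exp_sum)
    also have "(\<Sum>i\<in>UNIV. (cmod (w i))\<^sup>2) = (\<Sum>i\<in>J. (cmod (w i))\<^sup>2)"
      by (rule sum.mono_neutral_right) (auto simp: w_def)
    also have "\<dots> = \<theta> * (\<Sum>i\<in>J. (cmod (X \<omega> $ i))\<^sup>2 / ?b i)"
      unfolding sum_distrib_left
      using b \<theta>(1) by (intro sum.cong) (auto simp: w_def d_def norm_mult norm_divide power_mult_distrib power_divide)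
    finally show ?thesis by (simp add: ennreal_mult')
  qed
  have "ennreal (pi ^ CARD('n)) * (\<integral>\<^sup>+\<omega>. ennreal (exp (\<theta> * (\<Sum>i\<in>J. (cmod (X \<omega> $ i))\<^sup>2 / ?b i))) \<partial>M)
    = (\<integral>\<^sup>+\<omega>. \<integral>\<^sup>+g. G \<omega> g \<partial>lborel \<partial>M)"
    unfolding int_g by (rule nn_integral_cmult[symmetric]) measurable
  also have "\<dots> = (\<integral>\<^sup>+g. \<integral>\<^sup>+\<omega>. G \<omega> g \<partial>M \<partial>lborel)"
    by (rule Fubini'[OF G_meas, symmetric])
  \<comment> \<open>For fixed \<open>g\<close> the average over \<open>\<omega>\<close> is the
    generating function, with exponent at most \<open>\<theta> * n\<close> times the squared length
    of \<open>g\<close> on \<open>J\<close>. What remains is Gaussian in \<open>g\<close>, of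
    variance \<open>1 / (1 - \<theta> * n)\<close> on \<open>J\<close> and 1 elsewhere.\<close>
  also have "\<dots> \<le> (\<integral>\<^sup>+g. (\<Prod>i\<in>UNIV. ennreal (exp (- (cmod (g $ i))\<^sup>2 / (if i \<in> J then 1 / (1 - \<theta> * n) else 1)))) \<partial>lborel)"
  proof (rule nn_integral_mono)
    fix g :: "complex ^ 'n"
    have "Re (cvec_inner (diag_scale d (v g)) (B *v diag_scale d (v g))) = Re (cvec_inner (v g) (normalized_mat B *v v g))"
      by (simp add: normalized_mat_mult cvec_inner_diag_scale d_def)
    also have "cvec_inner (v g) (normalized_mat B *v v g)
      = (\<Sum>i\<in>J. v g $ i * cnj (\<Sum>j\<in>J. normalized_mat B $ i $ j * v g $ j))"
    proof -
      have "(normalized_mat B *v v g) $ i = (\<Sum>j\<in>J. normalized_mat B $ i $ j * v g $ j)" for i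
        unfolding matrix_vector_mult_def vec_lambda_beta by (rule sum.mono_neutral_right) (auto simp: v_def)
      then show ?thesis
        unfolding cvec_inner_def by (simp only:, intro sum.mono_neutral_right) (auto simp: v_def)
    qed
    also have "Re \<dots> \<le> n * (\<Sum>i\<in>J. (cmod (v g $ i))\<^sup>2)"
      unfolding n_def by (rule submat_quadratic_le)
    also have "\<dots> = \<theta> * n * (\<Sum>i\<in>J. (cmod (g $ i))\<^sup>2)"
      using \<theta>(1) by (simp add: v_def norm_mult power_mult_distrib sum_distrib_left mult_ac)
    finally have le: "Re (cvec_inner (diag_scale d (v g)) (B *v diag_scale d (v g))) \<le> \<theta> * n * (\<Sum>i\<in>J. (cmod (g $ i))\<^sup>2)" .
    have "\<theta> * n * (\<Sum>i\<in>J. (cmod (g $ i))\<^sup>2) = (\<Sum>i\<in>UNIV. if i \<in> J then \<theta> * n * (cmod (g $ i))\<^sup>2 else 0)"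
      by (simp add: sum_distrib_left sum.If_cases)
    then have eq: "\<theta> * n * (\<Sum>i\<in>J. (cmod (g $ i))\<^sup>2) + - (\<Sum>i\<in>UNIV. (cmod (g $ i))\<^sup>2)
      = (\<Sum>i\<in>UNIV. - (cmod (g $ i))\<^sup>2 / (if i \<in> J then 1 / (1 - \<theta> * n) else 1))"
      by (simp add: sum_negf[symmetric] sum.distrib[symmetric]) (rule sum.cong, auto simp: algebra_simps)
    have "(\<integral>\<^sup>+\<omega>. G \<omega> g \<partial>M) = ennreal (exp (Re (cvec_inner (diag_scale d (v g)) (B *v diag_scale d (v g)))))
        * ennreal (exp (- (\<Sum>i\<in>UNIV. (cmod (g $ i))\<^sup>2)))"
      unfolding G_def by (subst nn_integral_multc) (simp_all add: mgf)
    also have "\<dots> \<le> ennreal (exp (\<theta> * n * (\<Sum>i\<in>J. (cmod (g $ i))\<^sup>2) + - (\<Sum>i\<in>UNIV. (cmod (g $ i))\<^sup>2)))"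
      using le by (simp add: ennreal_mult'[symmetric] exp_add[symmetric])
    also have "\<dots> = (\<Prod>i\<in>UNIV. ennreal (exp (- (cmod (g $ i))\<^sup>2 / (if i \<in> J then 1 / (1 - \<theta> * n) else 1))))"
      unfolding eq by (simp add: exp_sum prod_ennreal)
    finally show "(\<integral>\<^sup>+\<omega>. G \<omega> g \<partial>M) \<le> (\<Prod>i\<in>UNIV. ennreal (exp (- (cmod (g $ i))\<^sup>2 / (if i \<in> J then 1 / (1 - \<theta> * n) else 1))))" .
  qed
  also have "\<dots> = (\<Prod>i\<in>UNIV. ennreal (pi * (if i \<in> J then 1 / (1 - \<theta> * n) else 1)))"
    using \<theta>(2) by (subst nn_integral_lborel_vec_prod, measurable)
      (intro prod.cong refl nn_integral_complex_gaussian, auto simp: n_def)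
  also have "\<dots> = ennreal (pi ^ CARD('n)) * ennreal ((1 / (1 - \<theta> * n)) ^ card J)"
    using \<theta>(2) by (subst prod_ennreal) (auto simp: n_def prod.distrib prod.If_cases ennreal_mult'[symmetric])
  finally show ?thesis
    unfolding n_def[symmetric] by (subst (asm) ennreal_mult_le_mult_iff) auto
qed

end

section \<open>Combining the bounds\<close>

text \<open>Integrating \<open>exp (\<theta> W) \<ge> exp (\<theta> a) (1 + \<theta> W - \<theta> a)\<close> over \<open>A\<close> replaces the use of
  Jensen's inequality.\<close>

lemma (in prob_space) prob_le_exponential_moment:
  fixes W :: "'a \<Rightarrow> real"
  assumes A [measurable]: "A \<in> events" and W: "integrable M W" and \<theta>: "0 \<le> \<theta>"
    and mean: "a * prob A \<le> (LINT \<omega>:A|M. W \<omega>)"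
    and moment: "(\<integral>\<^sup>+\<omega>. ennreal (exp (\<theta> * W \<omega>)) \<partial>M) \<le> ennreal m" and m: "0 \<le> m"
  shows "prob A \<le> exp (- \<theta> * a) * m"
proof -
  have [measurable]: "W \<in> borel_measurable M" using W by measurable
  have int_exp: "integrable M (\<lambda>\<omega>. exp (\<theta> * W \<omega>))"
    using moment by (intro integrableI_nonneg) (auto simp: le_less_trans)
  have "ennreal (LINT \<omega>|M. exp (\<theta> * W \<omega>)) \<le> ennreal m"
    using moment by (subst nn_integral_eq_integral[symmetric]) (auto simp: int_exp)
  then have le_m: "(LINT \<omega>|M. exp (\<theta> * W \<omega>)) \<le> m" using m by simp
  have int_W: "integrable M (\<lambda>\<omega>. indicator A \<omega> * W \<omega>)"
    using integrable_mult_indicator[OF A W] by simp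
  have int_1: "integrable M (\<lambda>\<omega>. indicator A \<omega> :: real)"
    by (intro integrable_real_indicator A) (simp add: less_top[symmetric])
  \<comment> \<open>The tangent line of the exponential at \<open>\<theta> * a\<close>, set to 0
    outside \<open>A\<close>, where it stays below the exponential.\<close>
  let ?f = "\<lambda>\<omega>. exp (\<theta> * a) * ((1 - \<theta> * a) * indicator A \<omega> + \<theta> * (indicator A \<omega> * W \<omega>))"
  have "exp (\<theta> * a) * prob A \<le> exp (\<theta> * a) * ((1 - \<theta> * a) * prob A + \<theta> * (LINT \<omega>:A|M. W \<omega>))"
    using mult_left_mono[OF mean \<theta>] by (intro mult_left_mono) (auto simp: algebra_simps)
  also have "\<dots> = (LINT \<omega>|M. ?f \<omega>)"
    using int_W int_1 by (simp add: set_lebesgue_integral_def)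
  also have "\<dots> \<le> (LINT \<omega>|M. exp (\<theta> * W \<omega>))"
  proof (rule integral_mono[OF _ int_exp])
    fix \<omega>
    have "exp (\<theta> * a) * (1 + (\<theta> * W \<omega> - \<theta> * a)) \<le> exp (\<theta> * a) * exp (\<theta> * W \<omega> - \<theta> * a)"
      by (intro mult_left_mono exp_ge_add_one_self) simp
    also have "\<dots> = exp (\<theta> * W \<omega>)" by (simp add: exp_add[symmetric])
    finally show "?f \<omega> \<le> exp (\<theta> * W \<omega>)"
      by (auto simp: indicator_def algebra_simps)
  qed (intro integrable_mult_right Bochner_Integration.integrable_add int_W int_1)
  finally have "exp (\<theta> * a) * prob A \<le> m" using le_m by linarith
  then have "exp (- \<theta> * a) * (exp (\<theta> * a) * prob A) \<le> exp (- \<theta> * a) * m"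
    by (rule mult_left_mono) simp
  then show ?thesis by (simp add: mult.assoc[symmetric] exp_add[symmetric])
qed

text \<open>The mean of \<open>W\<close> over \<open>A\<close> is at least
  \<open>t * card J\<close>, and its exponential moment is bounded by a power with exponent
  \<open>card J\<close>; so the Chebyshev bound is itself such a power.\<close>

lemma (in complex_gaussian_vector) prob_large_coordinates:
  assumes A [measurable]: "A \<in> events" and c: "1 \<le> c" "c < t"
    and norm_le: "submat_norm J (normalized_mat B) \<le> c"
    and mean: "\<And>i. i \<in> J \<Longrightarrow> t * Re (B $ i $ i) * prob A \<le> (LINT \<omega>:A|M. (cmod (X \<omega> $ i))\<^sup>2)"
  shows "prob A \<le> exp (1 - t / c + ln t) ^ card J"
proof -
  let ?b = "\<lambda>i. Re (B $ i $ i)"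
  define n where "n = submat_norm J (normalized_mat B)"
  \<comment> \<open>This value minimizes \<open>exp (- \<theta> * t) / (1 - \<theta> * c)\<close>;
    it gives \<open>1 - \<theta> * c = c / t\<close>.\<close>
  define \<theta> where "\<theta> = 1 / c - 1 / t"
  define W where "W = (\<lambda>\<omega>. \<Sum>i\<in>J. (cmod (X \<omega> $ i))\<^sup>2 / ?b i)"
  have t: "0 < t" "1 < t" using c by auto
  have \<theta>: "0 < \<theta>" using c t by (simp add: \<theta>_def divide_strict_left_mono)
  have "\<theta> * n \<le> \<theta> * c" using \<theta> norm_le by (simp add: n_def)
  also have "\<dots> = 1 - c / t" using c by (simp add: \<theta>_def left_diff_distrib)
  finally have \<theta>n: "c / t \<le> 1 - \<theta> * n" by simp
  have ct: "0 < c / t" using c t by simp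
  have int: "integrable M (\<lambda>\<omega>. (cmod (X \<omega> $ i))\<^sup>2)" for i
    using variance[of i] by (simp add: has_bochner_integral_iff)
  have int_A: "integrable M (\<lambda>\<omega>. indicator A \<omega> * (cmod (X \<omega> $ i))\<^sup>2)" for i
    using integrable_mult_indicator[OF A int] by simp
  have "prob A \<le> exp (- \<theta> * (t * card J)) * (1 / (1 - \<theta> * n)) ^ card J"
  proof (rule prob_le_exponential_moment[OF A, where W = W])
    show "integrable M W" unfolding W_def using int by (intro Bochner_Integration.integrable_sum integrable_divide_zero) auto
    show "(\<integral>\<^sup>+\<omega>. ennreal (exp (\<theta> * W \<omega>)) \<partial>M) \<le> ennreal ((1 / (1 - \<theta> * n)) ^ card J)"
      unfolding W_def n_def using \<theta> \<theta>n ct by (intro exponential_moment) (auto simp: n_def)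
    show "0 \<le> (1 / (1 - \<theta> * n)) ^ card J" using \<theta>n ct by simp
    have "t * real (card J) * prob A = (\<Sum>i\<in>J. t * ?b i * prob A / ?b i)"
      using Re_diag_pos by (simp add: less_imp_neq[symmetric])
    also have "\<dots> \<le> (\<Sum>i\<in>J. (LINT \<omega>:A|M. (cmod (X \<omega> $ i))\<^sup>2) / ?b i)"
      using Re_diag_pos by (intro sum_mono divide_right_mono mean) (auto simp: less_imp_le)
    also have "\<dots> = (LINT \<omega>:A|M. W \<omega>)"
      using int_A by (simp add: W_def set_lebesgue_integral_def sum_distrib_left)
    finally show "t * real (card J) * prob A \<le> (LINT \<omega>:A|M. W \<omega>)" .
  qed (use \<theta> in simp)
  also have "\<dots> \<le> exp (- \<theta> * (t * card J)) * t ^ card J"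
  proof (intro mult_left_mono power_mono)
    have "1 / (1 - \<theta> * n) \<le> 1 / (c / t)" using \<theta>n ct by (intro frac_le) auto
    \<comment> \<open>Here \<open>t / c\<close> is relaxed to \<open>t\<close> by
      \<open>c \<ge> 1\<close>; this produces the term \<open>ln t\<close>.\<close>
    also have "\<dots> \<le> t" using c t by (simp add: divide_le_eq)
    finally show "1 / (1 - \<theta> * n) \<le> t" .
  qed (use \<theta>n ct in auto)
  also have "\<dots> = (exp (- \<theta> * t) * t) ^ card J"
    by (simp add: power_mult_distrib exp_of_nat_mult[symmetric] mult_ac)
  also have "exp (- \<theta> * t) * t = exp (- \<theta> * t + ln t)"
    unfolding exp_add using t by simp
  also have "- \<theta> * t + ln t = 1 - t / c + ln t"
    using t by (simp add: \<theta>_def left_diff_distrib)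
  finally show ?thesis .
qed

text \<open>The unit diagonal makes the norm of the inverse at least 1, so a bound on the condition
  number bounds the norm itself, which is what \<open>prob_large_coordinates\<close> takes.\<close>

lemma submat_norm_le_condition_number:
  assumes "pos_def_hermitian C" "\<And>i. C $ i $ i = 1" "J \<noteq> {}"
    and "submat_norm J C * submat_norm J (submat_inv J C) \<le> c"
  shows "submat_norm J C \<le> c"
proof -
  from \<open>J \<noteq> {}\<close> obtain j where "j \<in> J" by blast
  then have "1 \<le> submat_norm J C" "1 \<le> submat_norm J (submat_inv J C)"
    using assms submat_norm_ge_1 submat_norm_inv_ge_1 by blast+
  then have "submat_norm J C * 1 \<le> submat_norm J C * submat_norm J (submat_inv J C)"
    by (intro mult_left_mono) auto
  with assms(4) show ?thesis by simp
qed

text \<open>Expanding a product of equal factors \<open>a + b\<close>: \<open>K\<close> collects the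
  indices where \<open>a\<close> is chosen.\<close>

lemma sum_subsets_binomial:
  fixes a b :: "'b::comm_semiring_1"
  shows "(\<Sum>K\<in>UNIV. a ^ card (K :: 'n::finite set) * b ^ card (- K)) = (a + b) ^ CARD('n)"
proof -
  have "(\<Prod>i\<in>(UNIV :: 'n set). a + b) = (\<Sum>K\<in>Pow (UNIV :: 'n set). (\<Prod>i\<in>K. a) * (\<Prod>i\<in>UNIV - K. b))"
    by (rule prod_add) simp
  then show ?thesis by (simp add: Compl_eq_Diff_UNIV)
qed

theorem theorem5p6:
  fixes M :: "'a measure"
    and X :: "'a \<Rightarrow> complex ^ 'n" and Y :: "'a \<Rightarrow> real ^ 'n"
    and B :: "complex ^ 'n ^ 'n"
    and c_N \<alpha> x y :: real
  defines "C \<equiv> correlation_mat M X"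
  defines "b \<equiv> onorm ((*v) C) * onorm ((*v) (matrix_inv C))"
  defines "\<mu> \<equiv> 1 - exp (- (x\<^sup>2 / onorm ((*v) C)))"
  assumes "prob_space M"
    and "c_N \<ge> 1" and "\<alpha> > 0"
    and "complex_gaussian M X B"
    and "Y \<in> borel_measurable M"
    and "prob_space.indep_set M
           (sets (vimage_algebra (space M) X borel)) (sets (vimage_algebra (space M) Y borel))"
    and "\<And>A. A \<in> sets (vimage_algebra (space M) Y borel) \<Longrightarrow> measure M A > 0 \<Longrightarrow>
           \<exists>(Z :: 'a \<Rightarrow> complex ^ 'n) B\<^sub>A. complex_gaussian M Z B\<^sub>A \<and>
             (\<forall>i. (LINT \<omega>|M. \<bar>Y \<omega> $ i\<bar>\<^sup>2) \<ge> \<alpha>\<^sup>2 * (LINT \<omega>|M. (cmod (Z \<omega> $ i))\<^sup>2) \<and>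
                  event_expectation M A (\<lambda>\<omega>. \<bar>Y \<omega> $ i\<bar>\<^sup>2)
                    \<le> event_expectation M A (\<lambda>\<omega>. (cmod (Z \<omega> $ i))\<^sup>2)) \<and>
             (\<forall>I. I \<subset> UNIV \<longrightarrow>
                  submat_norm (- I) (correlation_mat M Z)
                    * submat_norm (- I) (submat_inv (- I) (correlation_mat M Z)) \<le> c_N)"
    and "x \<ge> 0" and "y > sqrt (2 * c_N) / \<alpha>"
  shows "1 - measure M {\<omega> \<in> space M. \<exists>i.
             (cmod (X \<omega> $ i))\<^sup>2 \<ge> x\<^sup>2 * cvar M (\<lambda>\<omega>. X \<omega> $ i) \<and>
             \<bar>Y \<omega> $ i\<bar>\<^sup>2 \<le> y\<^sup>2 * (LINT \<omega>|M. \<bar>Y \<omega> $ i\<bar>\<^sup>2)}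
         \<le> (exp 1 * \<alpha>\<^sup>2 * y\<^sup>2 / (\<alpha>\<^sup>2 * y\<^sup>2 - 2 * c_N)) *
           (b * (\<mu> + (1 - \<mu>) * exp (1 - \<alpha>\<^sup>2 * y\<^sup>2 / c_N + 2 * ln (\<alpha> * y)))) ^ CARD('n)"
proof -
  interpret X: complex_gaussian_vector M X B
    using assms(4,7) by (simp add: complex_gaussian_vector_def complex_gaussian_vector_axioms_def)
  note [measurable] = \<open>Y \<in> borel_measurable M\<close>
  define t where "t = \<alpha>\<^sup>2 * y\<^sup>2"
  define q where "q = exp (1 - t / c_N + 2 * ln (\<alpha> * y))"
  have "sqrt (2 * c_N) < \<alpha> * y"
    using \<open>\<alpha> > 0\<close> \<open>y > sqrt (2 * c_N) / \<alpha>\<close> by (simp add: divide_less_eq mult.commute)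
  moreover have "0 < sqrt (2 * c_N)" using \<open>c_N \<ge> 1\<close> by simp
  ultimately have \<alpha>y: "0 < \<alpha> * y" and "(sqrt (2 * c_N))\<^sup>2 < (\<alpha> * y)\<^sup>2"
    by (linarith, intro power_strict_mono) auto
  then have t: "2 * c_N < t" using \<open>c_N \<ge> 1\<close> by (simp add: t_def power_mult_distrib)
  have "ln t = 2 * ln (\<alpha> * y)"
    using ln_realpow[of "\<alpha> * y" 2] by (simp add: t_def power_mult_distrib)
  then have q: "q = exp (1 - t / c_N + ln t)" by (simp add: q_def)
  define E where "E i = (LINT \<omega>|M. \<bar>Y \<omega> $ i\<bar>\<^sup>2)" for i
  define A where "A L = {\<omega> \<in> space M. \<forall>i\<in>L. y\<^sup>2 * E i < \<bar>Y \<omega> $ i\<bar>\<^sup>2}" for L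
  define S where "S K = {\<omega> \<in> space M. \<forall>i. (cmod (X \<omega> $ i))\<^sup>2 < x\<^sup>2 * Re (B $ i $ i) \<longleftrightarrow> i \<in> K}" for K
  \<comment> \<open>Membership in the sigma-algebra generated by \<open>Y\<close> serves both the
    hypothesis supplying \<open>Z\<close> and independence.\<close>
  have A_sets: "A L \<in> sets (vimage_algebra (space M) Y borel)" for L
  proof -
    have "A L = Y -` {v. \<forall>i\<in>L. y\<^sup>2 * E i < \<bar>v $ i\<bar>\<^sup>2} \<inter> space M" by (auto simp: A_def)
    moreover have "{v. \<forall>i\<in>L. y\<^sup>2 * E i < \<bar>v $ i\<bar>\<^sup>2} \<in> sets (borel :: (real ^ 'n) measure)" by measurable
    ultimately show ?thesis by (simp only: in_vimage_algebra)
  qed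
  have S_sets: "S K \<in> sets (vimage_algebra (space M) X borel)" for K
  proof -
    have "S K = X -` {v. \<forall>i. (cmod (v $ i))\<^sup>2 < x\<^sup>2 * Re (B $ i $ i) \<longleftrightarrow> i \<in> K} \<inter> space M" by (auto simp: S_def)
    moreover have "{v. \<forall>i. (cmod (v $ i))\<^sup>2 < x\<^sup>2 * Re (B $ i $ i) \<longleftrightarrow> i \<in> K} \<in> sets (borel :: (complex ^ 'n) measure)"
      by measurable
    ultimately show ?thesis by (simp only: in_vimage_algebra)
  qed
  have [measurable]: "A L \<in> X.events" "S K \<in> X.events" for L K
    unfolding A_def S_def by measurable
  have prob_A: "X.prob (A L) \<le> q ^ card L" for L
  \<comment> \<open>\<open>Z\<close> is supplied only for positive probability, and its norm bound
    only for a proper \<open>I = - L\<close>, that is, nonempty \<open>L\<close>. The excluded cases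
    follow from \<open>q > 0\<close> and from probabilities being at most 1.\<close>
  proof (cases "X.prob (A L) = 0 \<or> L = {}")
    case True
    then show ?thesis by (auto simp: q_def)
  next
    case False
    then have pos: "0 < X.prob (A L)" and "L \<noteq> {}" by (auto simp: zero_less_measure_iff)
    obtain Z B' where Z: "complex_gaussian M Z B'"
      and Z1: "\<And>i. \<alpha>\<^sup>2 * (LINT \<omega>|M. (cmod (Z \<omega> $ i))\<^sup>2) \<le> E i"
      and Z2: "\<And>i. event_expectation M (A L) (\<lambda>\<omega>. \<bar>Y \<omega> $ i\<bar>\<^sup>2)
                    \<le> event_expectation M (A L) (\<lambda>\<omega>. (cmod (Z \<omega> $ i))\<^sup>2)"
      and Z3: "\<And>I. I \<subset> UNIV \<Longrightarrow> submat_norm (- I) (correlation_mat M Z)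
                    * submat_norm (- I) (submat_inv (- I) (correlation_mat M Z)) \<le> c_N"
      using assms(10)[OF A_sets pos] unfolding E_def by blast
    interpret Z: complex_gaussian_vector M Z B'
      using assms(4) Z by (simp add: complex_gaussian_vector_def complex_gaussian_vector_axioms_def)
    have var: "(LINT \<omega>|M. (cmod (Z \<omega> $ i))\<^sup>2) = Re (B' $ i $ i)" for i
      using Z.cvar_X by (simp add: cvar_def)
    have "- L \<subset> UNIV" using \<open>L \<noteq> {}\<close> by auto
    then have "submat_norm L (normalized_mat B') \<le> c_N"
      using Z3[of "- L"] \<open>L \<noteq> {}\<close> pos_def_normalized_mat[OF Z.pos_def] normalized_mat_diag[OF Z.pos_def]
      by (intro submat_norm_le_condition_number) (auto simp: Z.correlation_mat_X)
    moreover have "t * Re (B' $ i $ i) * X.prob (A L) \<le> (LINT \<omega>:A L|M. (cmod (Z \<omega> $ i))\<^sup>2)" if "i \<in> L" for i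
    proof -
      \<comment> \<open>The Bochner integral of a non-integrable function is 0, so a positive lower
        bound for \<open>E i\<close> implies integrability.\<close>
      have "0 < \<alpha>\<^sup>2 * Re (B' $ i $ i)" using \<open>\<alpha> > 0\<close> Z.Re_diag_pos by simp
      then have "E i \<noteq> 0" using Z1[of i] by (simp add: var)
      then have int: "integrable M (\<lambda>\<omega>. \<bar>Y \<omega> $ i\<bar>\<^sup>2)"
        unfolding E_def by (metis not_integrable_integral_eq)
      \<comment> \<open>\<open>Z1\<close> bounds the variance of \<open>Z\<close> through
        \<open>E i\<close>, the definition of \<open>A L\<close> passes to the integral of the
        squared \<open>Y\<close> coordinate over the event, and \<open>Z2\<close> returns to
        \<open>Z\<close>.\<close>
      have "t * Re (B' $ i $ i) * X.prob (A L) = y\<^sup>2 * (\<alpha>\<^sup>2 * Re (B' $ i $ i)) * X.prob (A L)"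
        by (simp add: t_def)
      also have "\<dots> \<le> y\<^sup>2 * E i * X.prob (A L)"
        using Z1[of i] by (intro mult_right_mono mult_left_mono) (auto simp: var)
      also have "\<dots> = (LINT \<omega>:A L|M. y\<^sup>2 * E i)"
        by (simp add: set_lebesgue_integral_def)
      also have "\<dots> \<le> (LINT \<omega>:A L|M. \<bar>Y \<omega> $ i\<bar>\<^sup>2)"
        unfolding set_lebesgue_integral_def
      proof (rule integral_mono)
        show "integrable M (\<lambda>\<omega>. indicator (A L) \<omega> *\<^sub>R (y\<^sup>2 * E i))"
          by (intro integrable_mult_indicator) auto
        show "integrable M (\<lambda>\<omega>. indicator (A L) \<omega> *\<^sub>R \<bar>Y \<omega> $ i\<bar>\<^sup>2)"
          using int by (intro integrable_mult_indicator) auto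
      qed (use that in \<open>auto simp: indicator_def A_def\<close>)
      also have "\<dots> \<le> (LINT \<omega>:A L|M. (cmod (Z \<omega> $ i))\<^sup>2)"
        using Z2[of i] pos by (simp add: event_expectation_def divide_le_cancel)
      finally show ?thesis .
    qed
    ultimately show ?thesis
      unfolding q using \<open>c_N \<ge> 1\<close> t by (intro Z.prob_large_coordinates) auto
  qed
  define G where "G = {\<omega> \<in> space M. \<exists>i. (cmod (X \<omega> $ i))\<^sup>2 \<ge> x\<^sup>2 * cvar M (\<lambda>\<omega>. X \<omega> $ i) \<and>
             \<bar>Y \<omega> $ i\<bar>\<^sup>2 \<le> y\<^sup>2 * (LINT \<omega>|M. \<bar>Y \<omega> $ i\<bar>\<^sup>2)}"
  have [measurable]: "G \<in> X.events" unfolding G_def by measurable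
  have C: "C = normalized_mat B" by (simp add: C_def X.correlation_mat_X)
  have b: "1 \<le> b"
    using mult_mono[OF onorm_normalized_mat_ge_1(1)[OF X.pos_def] onorm_normalized_mat_ge_1(2)[OF X.pos_def]]
      onorm_normalized_mat_ge_1[OF X.pos_def] by (simp add: b_def C)
  have \<mu>: "0 \<le> \<mu>" "0 \<le> 1 - \<mu>"
    using onorm_normalized_mat_ge_1(1)[OF X.pos_def] by (auto simp: \<mu>_def C)
  have "space M - G \<subseteq> (\<Union>K\<in>UNIV. S K \<inter> A (- K))"
  proof
    fix \<omega> assume "\<omega> \<in> space M - G"
    then have "\<omega> \<in> S {i. (cmod (X \<omega> $ i))\<^sup>2 < x\<^sup>2 * Re (B $ i $ i)} \<inter> A (- {i. (cmod (X \<omega> $ i))\<^sup>2 < x\<^sup>2 * Re (B $ i $ i)})"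
      by (auto simp: S_def A_def G_def E_def X.cvar_X not_less not_le)
    then show "\<omega> \<in> (\<Union>K\<in>UNIV. S K \<inter> A (- K))" by blast
  qed
  then have "X.prob (space M - G) \<le> X.prob (\<Union>K\<in>UNIV. S K \<inter> A (- K))"
    by (intro X.finite_measure_mono) auto
  also have "\<dots> \<le> (\<Sum>K\<in>UNIV. X.prob (S K \<inter> A (- K)))"
    by (intro X.finite_measure_subadditive_finite) auto
  also have "\<dots> = (\<Sum>K\<in>UNIV. X.prob (S K) * X.prob (A (- K)))"
    by (intro sum.cong refl X.indep_setD[OF assms(9)] S_sets A_sets)
  also have "\<dots> \<le> (\<Sum>K\<in>(UNIV :: 'n set set). (b ^ CARD('n) * (\<mu> ^ card K * (1 - \<mu>) ^ card (- K))) * q ^ card (- K))"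
    using X.prob_small_coordinates[of x] b \<mu>
    by (intro sum_mono mult_mono prob_A) (auto simp: S_def b_def C \<mu>_def)
  also have "\<dots> = b ^ CARD('n) * (\<Sum>K\<in>UNIV. \<mu> ^ card (K :: 'n set) * ((1 - \<mu>) * q) ^ card (- K))"
    by (simp add: sum_distrib_left power_mult_distrib mult_ac)
  also have "\<dots> = (b * (\<mu> + (1 - \<mu>) * q)) ^ CARD('n)"
    by (simp add: sum_subsets_binomial power_mult_distrib[of b])
  \<comment> \<open>The prefactor is at least 1: its denominator is positive and at most
    \<open>t\<close>, its numerator at least \<open>t\<close>.\<close>
  also have "\<dots> \<le> (exp 1 * t / (t - 2 * c_N)) * (b * (\<mu> + (1 - \<mu>) * q)) ^ CARD('n)"
  proof -
    have "t - 2 * c_N \<le> 1 * t" using \<open>c_N \<ge> 1\<close> by simp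
    also have "\<dots> \<le> exp 1 * t" using t \<open>c_N \<ge> 1\<close> by (intro mult_right_mono) auto
    finally have "1 \<le> exp 1 * t / (t - 2 * c_N)" using t by simp
    moreover have "0 \<le> (b * (\<mu> + (1 - \<mu>) * q)) ^ CARD('n)"
      using b \<mu> by (simp add: q_def)
    ultimately show ?thesis using mult_right_mono by fastforce
  qed
  finally show ?thesis
    using X.prob_compl[of G] by (simp add: G_def t_def q_def mult.assoc)
qed

end
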